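(* Every two-bridge knot complement and every non-trivial two-bridge link complement has a finite cover which is a great circle link complement. That is, for every pair of coprime integers $p,q$ with $q\neq 0$, there is a great circle link $L\subset S^3$ such that $S^3-L$ is a finite-sheeted cover of $S^3-\mathbf{k}_{p/q}$.
   Context: A great circle link is a link in the unit three-sphere $S^3\subset\mathbb{R}^4$ (round metric) all of whose components are geodesics of $S^3$, i.e. great circles (intersections of $S^3$ with two-planes through the origin in $\mathbb{R}^4$). Two-bridge (rational) knots and links: identify the sphere with four marked points with the pillowcase $\mathbb{R}^2/\Lambda$, where $\Lambda$ is the group generated by the rotations by $\pi$ about the points of $\mathbb{Z}^2$; the four marked points are the images of $\mathbb{Z}^2$, and for $p/q\in\mathbb{Q}\cup\{\infty\}$ in lowest terms (with $\infty=1/0$) the arcs of slope $p/q$ are the images of the lines of slope $p/q$ through points of $\mathbb{Z}^2$ (there are two such arcs, each joining two marked points). Let $B$ and $B'$ be two balls whose boundaries are each identified with this four-marked sphere, each containing two disjoint properly embedded standard "vertical" arcs with endpoints the four marked points, simultaneously parallel (through disjoint disks) to the two arcs of slope $\infty$ on the boundary. Let $h_{p/q}:\partial B\to\partial B'$ be a homeomorphism preserving the set of marked points, linear in the pillowcase coordinates, taking the arcs of slope $\infty$ on $\partial B$ to the arcs of slope $p/q$ on $\partial B'$. Then $\mathbf{k}_{p/q}$ is the union of the marked arcs in the three-sphere $S^3=B\cup_{h_{p/q}}B'$. The two-bridge knots and links are the $\mathbf{k}_{p/q}$ with $\gcd(p,q)=1$; $\mathbf{k}_{p/q}$ is a knot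 if $q$ is odd and a two-component link if $q$ is even. The case $p/q=1/0=\infty$ is the trivial two-component link, and "non-trivial" means that this case is excluded. *)

theory Defs
  imports "HOL-Analysis.Analysis"
begin

section \<open>Great circle links\<close>

definition great_circle :: "(real^4) set \<Rightarrow> bool"
  where "great_circle C \<longleftrightarrow> (\<exists>P. subspace P \<and> dim P = 2 \<and> C = P \<inter> sphere 0 1)"

definition great_circle_link :: "(real^4) set \<Rightarrow> bool"
  where "great_circle_link L \<longleftrightarrow>
    (\<exists>\<C>. finite \<C> \<and> \<C> \<noteq> {} \<and> (\<forall>C\<in>\<C>. great_circle C) \<and> pairwise disjnt \<C> \<and> L = \<Union>\<C>)"

definition finite_sheeted_covering ::
    "'a::topological_space set \<Rightarrow> ('a \<Rightarrow> 'b::topological_space) \<Rightarrow> 'b set \<Rightarrow> bool"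
  where "finite_sheeted_covering E c X \<longleftrightarrow>
    covering_space E c X \<and> (\<exists>n. \<forall>x\<in>X. finite {e \<in> E. c e = x} \<and> card {e \<in> E. c e = x} = n)"

section \<open>The pillowcase\<close>

text \<open>
  \<open>pillow\<close> realises the quotient map from the plane to the pillowcase as a map onto an embedded
  sphere in three-space: its fibres are exactly the orbits of the group generated by the
  rotations by \<open>\<pi>\<close> about the integer points, see \<open>pillow_eq_iff\<close> below.
\<close>

definition pillow :: "real \<times> real \<Rightarrow> real \<times> real \<times> real"
  where "pillow = (\<lambda>(x, y). (cos (pi * x), cos (pi * y), sin (pi * x) * sin (pi * y)))"

definition pillowcase :: "(real \<times> real \<times> real) set"
  where "pillowcase = range pillow"

definition marked_points :: "(real \<times> real \<times> real) set"
  where "marked_points = pillow ` (\<int> \<times> \<int>)"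

text \<open>
  The union of the arcs of slope \<open>p/q\<close>; a line of slope \<open>p/q\<close> has direction \<open>(q, p)\<close>, so
  \<open>slope_arcs 1 0\<close> has slope \<open>\<infinity>\<close>.
\<close>

definition slope_arcs :: "int \<Rightarrow> int \<Rightarrow> (real \<times> real \<times> real) set"
  where "slope_arcs p q =
    {pillow (of_int m + t * of_int q, of_int n + t * of_int p) | m n t. True}"

section \<open>The standard ball with its two vertical arcs\<close>

text \<open>
  The compact convex body bounded by the pillowcase (\<open>frontier_pillow_ball\<close>).
\<close>

definition pillow_ball :: "(real \<times> real \<times> real) set"
  where "pillow_ball = {(a, b, c). \<bar>a\<bar> \<le> 1 \<and> \<bar>b\<bar> \<le> 1 \<and> c\<^sup>2 \<le> (1 - a\<^sup>2) * (1 - b\<^sup>2)}"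

text \<open>
  The arcs of slope \<open>\<infinity>\<close> are the straight segments \<open>{(\<plusminus>1, b, 0) | \<bar>b\<bar> \<le> 1}\<close>. They are
  pushed into the interior of the ball, with endpoints fixed, across the two disjoint planar disks
  \<open>{(a, b, 0) | \<bar>b\<bar> \<le> 1, (1 + b\<^sup>2)/2 \<le> \<plusminus>a \<le> 1}\<close>.
\<close>

definition vertical_arcs :: "(real \<times> real \<times> real) set"
  where "vertical_arcs = {(a, b, 0) | a b. \<bar>b\<bar> \<le> 1 \<and> \<bar>a\<bar> = (1 + b\<^sup>2) / 2}"

section \<open>Two-bridge knots and links\<close>

definition two_bridge_gluing ::
    "int \<Rightarrow> int \<Rightarrow> (real \<times> real \<times> real \<Rightarrow> real \<times> real \<times> real) \<Rightarrow> bool"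
  where "two_bridge_gluing p q h \<longleftrightarrow>
    (\<exists>g. homeomorphism pillowcase pillowcase h g) \<and>
    h ` marked_points = marked_points \<and>
    (\<exists>A. linear A \<and> (\<forall>v. h (pillow v) = pillow (A v))) \<and>
    h ` slope_arcs 1 0 = slope_arcs p q"

text \<open>
  The link \<open>K\<close> in the unit three-sphere is a copy of \<open>\<^bold>k\<close> with parameter \<open>p/q\<close>: the sphere is
  the union of two embedded copies \<open>f ` pillow_ball\<close> and \<open>f' ` pillow_ball\<close> of the standard ball,
  glued along their boundaries by precisely \<open>h\<close>, and \<open>K\<close> is the union of the vertical arcs of the
  two copies. Equivalently, \<open>(f, f')\<close> is a homeomorphism from the adjunction space
  of the two balls along \<open>h\<close> to the sphere. Such \<open>K\<close> exist for all coprime \<open>p\<close>, \<open>q\<close>, see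
  \<open>two_bridge_exists\<close>.
\<close>

definition two_bridge :: "int \<Rightarrow> int \<Rightarrow> (real^4) set \<Rightarrow> bool"
  where "two_bridge p q K \<longleftrightarrow>
    (\<exists>h f f'.
      two_bridge_gluing p q h \<and>
      continuous_on pillow_ball f \<and> inj_on f pillow_ball \<and>
      continuous_on pillow_ball f' \<and> inj_on f' pillow_ball \<and>
      f ` pillow_ball \<union> f' ` pillow_ball = sphere 0 1 \<and>
      f ` pillow_ball \<inter> f' ` pillow_ball = f ` pillowcase \<and>
      (\<forall>x\<in>pillowcase. f x = f' (h x)) \<and>
      K = f ` vertical_arcs \<union> f' ` vertical_arcs)"

section \<open>The pillowcase is the quotient of the plane\<close>

lemma cos_pi_eq_iff:
  fixes x y :: real
  shows "cos (pi * x) = cos (pi * y) \<longleftrightarrow> (\<exists>n::int. x = y + 2 * of_int n \<or> x = 2 * of_int n - y)"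
proof -
  have "cos (pi * x) = cos (pi * y) \<longleftrightarrow>
      (\<exists>n\<in>\<int>. pi * x = pi * y + 2 * n * pi \<or> pi * x = - (pi * y) + 2 * n * pi)"
    by (rule cos_eq)
  also have "\<dots> \<longleftrightarrow> (\<exists>n\<in>\<int>. x = y + 2 * n \<or> x = 2 * n - y)"
  proof (rule bex_cong[OF refl])
    fix n :: real
    have "pi * x = pi * y + 2 * n * pi \<longleftrightarrow> pi * x = pi * (y + 2 * n)"
      "pi * x = - (pi * y) + 2 * n * pi \<longleftrightarrow> pi * x = pi * (2 * n - y)"
      by (simp_all add: algebra_simps)
    then show "(pi * x = pi * y + 2 * n * pi \<or> pi * x = - (pi * y) + 2 * n * pi) \<longleftrightarrow>
        (x = y + 2 * n \<or> x = 2 * n - y)"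
      by simp
  qed
  also have "\<dots> \<longleftrightarrow> (\<exists>n::int. x = y + 2 * of_int n \<or> x = 2 * of_int n - y)"
    by (auto simp: Ints_def)
  finally show ?thesis .
qed

lemma sin_pi_shift:
  "sin (pi * (y + 2 * of_int n)) = sin (pi * y)" "sin (pi * (2 * of_int n - y)) = - sin (pi * y)"
proof -
  have "pi * (y + 2 * of_int n) = pi * y + 2 * pi * of_int n"
    "pi * (2 * of_int n - y) = - (pi * y) + 2 * pi * of_int n"
    by (simp_all add: algebra_simps)
  then show "sin (pi * (y + 2 * of_int n)) = sin (pi * y)"
    "sin (pi * (2 * of_int n - y)) = - sin (pi * y)"
    by (simp_all only: sin_add cos_int_2pin sin_int_2pin) simp_all
qed

lemma pillow_eq_iff:
  "pillow v = pillow w \<longleftrightarrow>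
    (\<exists>m n::int. v = w + 2 *\<^sub>R (of_int m, of_int n) \<or> v = 2 *\<^sub>R (of_int m, of_int n) - w)"
proof -
  obtain x y where v: "v = (x, y)" by (cases v)
  obtain x' y' where w: "w = (x', y')" by (cases w)
  show ?thesis
  proof
    assume "pillow v = pillow w"
    then have c: "cos (pi * x) = cos (pi * x')" "cos (pi * y) = cos (pi * y')"
      and s: "sin (pi * x) * sin (pi * y) = sin (pi * x') * sin (pi * y')"
      by (auto simp: pillow_def v w)
    from c obtain m n :: int where
      m: "x = x' + 2 * of_int m \<or> x = 2 * of_int m - x'" and
      n: "y = y' + 2 * of_int n \<or> y = 2 * of_int n - y'"
      unfolding cos_pi_eq_iff by blast
    have mixed: "\<exists>i::int. t = of_int i" if "sin (pi * t) = 0" for t :: real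
    proof -
      from that obtain i :: int where "pi * t = of_int i * pi"
        by (auto simp: sin_zero_iff_int2)
      then have "pi * t = pi * of_int i" by simp
      then show ?thesis by auto
    qed
    have *: "(\<exists>i::int. x' = of_int i) \<or> (\<exists>i::int. y' = of_int i)"
      if "sin (pi * x') * sin (pi * y') = - (sin (pi * x') * sin (pi * y'))"
      using that mixed[of x'] mixed[of y'] by auto
    have goal: ?thesis if "\<exists>m n::int. (x = x' + 2 * of_int m \<and> y = y' + 2 * of_int n) \<or>
        (x = 2 * of_int m - x' \<and> y = 2 * of_int n - y')"
      using that \<open>pillow v = pillow w\<close> by (auto simp: v w)
    have fix_int: "\<exists>k::int. z = z' + 2 * of_int k" "\<exists>k::int. z = 2 * of_int k - z'"
      if "z = z' + 2 * of_int m \<or> z = 2 * of_int m - z'" "z' = of_int i" for z z' :: real and m i :: int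
    proof -
      show "\<exists>k::int. z = z' + 2 * of_int k"
        using that by (auto intro: exI[of _ m] exI[of _ "m - i"])
      show "\<exists>k::int. z = 2 * of_int k - z'"
        using that by (auto intro: exI[of _ m] exI[of _ "m + i"])
    qed
    consider "x = x' + 2 * of_int m \<and> y = y' + 2 * of_int n"
      | "x = 2 * of_int m - x' \<and> y = 2 * of_int n - y'"
      | "(x = x' + 2 * of_int m \<and> y = 2 * of_int n - y') \<or> (x = 2 * of_int m - x' \<and> y = y' + 2 * of_int n)"
      using m n by blast
    then have "\<exists>m n::int. (x = x' + 2 * of_int m \<and> y = y' + 2 * of_int n) \<or>
        (x = 2 * of_int m - x' \<and> y = 2 * of_int n - y')"
    proof cases
      case 3
      then have "sin (pi * x') * sin (pi * y') = - (sin (pi * x') * sin (pi * y'))"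
        using s by (auto simp: sin_pi_shift)
      from *[OF this] show ?thesis
        using 3 fix_int[OF m] fix_int[OF n] by metis
    qed blast+
    then show "\<exists>m n::int. v = w + 2 *\<^sub>R (of_int m, of_int n) \<or> v = 2 *\<^sub>R (of_int m, of_int n) - w"
      by (auto simp: v w)
  next
    assume "\<exists>m n::int. v = w + 2 *\<^sub>R (of_int m, of_int n) \<or> v = 2 *\<^sub>R (of_int m, of_int n) - w"
    then show "pillow v = pillow w"
      unfolding v w by (auto simp: pillow_def sin_pi_shift cos_pi_eq_iff)
  qed
qed

section \<open>The pillowcase bounds a convex ball\<close>

lemma pillow_ball_closed: "closed pillow_ball"
proof -
  have "pillow_ball = {v. \<bar>fst v\<bar> \<le> 1} \<inter> {v. \<bar>fst (snd v)\<bar> \<le> 1} \<inter>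
      {v. (snd (snd v))\<^sup>2 \<le> (1 - (fst v)\<^sup>2) * (1 - (fst (snd v))\<^sup>2)}"
    by (auto simp: pillow_ball_def)
  moreover have "closed \<dots>"
    by (intro closed_Int closed_Collect_le continuous_intros)
  ultimately show ?thesis by simp
qed

lemma pillow_ball_bounds:
  assumes "(a, b, c) \<in> pillow_ball"
  shows "\<bar>a\<bar> \<le> 1" "\<bar>b\<bar> \<le> 1" "\<bar>c\<bar> \<le> 1"
proof -
  show ab: "\<bar>a\<bar> \<le> 1" "\<bar>b\<bar> \<le> 1" using assms by (auto simp: pillow_ball_def)
  have "c\<^sup>2 \<le> (1 - a\<^sup>2) * (1 - b\<^sup>2)" using assms by (auto simp: pillow_ball_def)
  also have "\<dots> \<le> 1 * 1"
    using ab by (intro mult_mono) (auto simp: abs_square_le_1)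
  finally show "\<bar>c\<bar> \<le> 1" by (simp add: abs_square_le_1)
qed

lemma pillow_ball_compact: "compact pillow_ball"
proof -
  have "pillow_ball \<subseteq> {-1..1} \<times> {-1..1} \<times> {-1..1}"
    using pillow_ball_bounds by (fastforce simp: abs_le_iff)
  then have "bounded pillow_ball"
    by (rule bounded_subset[rotated]) (intro bounded_Times; simp)
  then show ?thesis
    using pillow_ball_closed by (simp add: compact_eq_bounded_closed)
qed

lemma square_convex:
  fixes a b s t :: real
  assumes "0 \<le> s" "0 \<le> t" "s + t = 1"
  shows "(s * a + t * b)\<^sup>2 \<le> s * a\<^sup>2 + t * b\<^sup>2"
proof -
  have t: "t = 1 - s" using assms by simp
  have "s * a\<^sup>2 + t * b\<^sup>2 - (s * a + t * b)\<^sup>2 = s * t * (a - b)\<^sup>2"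
    unfolding t by algebra
  moreover have "0 \<le> s * t * (a - b)\<^sup>2" using assms by simp
  ultimately show ?thesis by linarith
qed

lemma pillow_ball_convex: "convex pillow_ball"
proof (rule convexI)
  fix v w :: "real \<times> real \<times> real" and s t :: real
  assume vw: "v \<in> pillow_ball" "w \<in> pillow_ball" and st: "0 \<le> s" "0 \<le> t" "s + t = 1"
  obtain a b c where v: "v = (a, b, c)" by (cases v)
  obtain a' b' c' where w: "w = (a', b', c')" by (cases w)
  define A B C where "A = s * a + t * a'" and "B = s * b + t * b'" and "C = s * c + t * c'"
  define u u' z z' where "u = 1 - a\<^sup>2" and "u' = 1 - a'\<^sup>2" and "z = 1 - b\<^sup>2" and "z' = 1 - b'\<^sup>2"
  have nn: "0 \<le> u" "0 \<le> u'" "0 \<le> z" "0 \<le> z'"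
    using vw by (auto simp: v w pillow_ball_def u_def u'_def z_def z'_def abs_square_le_1)
  have c: "c\<^sup>2 \<le> u * z" "c'\<^sup>2 \<le> u' * z'"
    using vw by (auto simp: v w pillow_ball_def u_def u'_def z_def z'_def)
  have U: "s * u + t * u' \<le> 1 - A\<^sup>2"
    using square_convex[OF st, of a a'] st by (simp add: u_def u'_def A_def algebra_simps)
  have Z: "s * z + t * z' \<le> 1 - B\<^sup>2"
    using square_convex[OF st, of b b'] st by (simp add: z_def z'_def B_def algebra_simps)
  have U0: "0 \<le> s * u + t * u'" and Z0: "0 \<le> s * z + t * z'"
    using st nn by auto
  have "(2 * (c * c'))\<^sup>2 = 4 * (c\<^sup>2 * c'\<^sup>2)" by algebra
  also have "\<dots> \<le> 4 * ((u * z) * (u' * z'))"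
    using c nn by (intro mult_left_mono mult_mono) auto
  also have "\<dots> = (u * z' + u' * z)\<^sup>2 - (u * z' - u' * z)\<^sup>2" by algebra
  also have "\<dots> \<le> (u * z' + u' * z)\<^sup>2" by simp
  finally have cc: "2 * (c * c') \<le> u * z' + u' * z"
    using nn by (intro power2_le_imp_le[of "2 * (c * c')"]) auto
  have "C\<^sup>2 = s\<^sup>2 * c\<^sup>2 + t\<^sup>2 * c'\<^sup>2 + (s * t) * (2 * (c * c'))"
    unfolding C_def by algebra
  also have "\<dots> \<le> s\<^sup>2 * (u * z) + t\<^sup>2 * (u' * z') + (s * t) * (u * z' + u' * z)"
    using c cc st by (intro add_mono mult_left_mono) auto
  also have "\<dots> = (s * u + t * u') * (s * z + t * z')" by algebra
  also have "\<dots> \<le> (1 - A\<^sup>2) * (1 - B\<^sup>2)"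
    using U Z U0 Z0 by (intro mult_mono) auto
  finally have "C\<^sup>2 \<le> (1 - A\<^sup>2) * (1 - B\<^sup>2)" .
  moreover have "A\<^sup>2 \<le> 1" "B\<^sup>2 \<le> 1" using U U0 Z Z0 by auto
  ultimately show "s *\<^sub>R v + t *\<^sub>R w \<in> pillow_ball"
    by (simp add: v w pillow_ball_def A_def B_def C_def abs_square_le_1)
qed

lemma pillowcase_eq:
  "pillowcase = {(a, b, c). \<bar>a\<bar> \<le> 1 \<and> \<bar>b\<bar> \<le> 1 \<and> c\<^sup>2 = (1 - a\<^sup>2) * (1 - b\<^sup>2)}"
proof (intro equalityI subsetI)
  fix v assume "v \<in> pillowcase"
  then show "v \<in> {(a, b, c). \<bar>a\<bar> \<le> 1 \<and> \<bar>b\<bar> \<le> 1 \<and> c\<^sup>2 = (1 - a\<^sup>2) * (1 - b\<^sup>2)}"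
    by (auto simp: pillowcase_def pillow_def power_mult_distrib sin_squared_eq)
next
  fix v :: "real \<times> real \<times> real"
  assume "v \<in> {(a, b, c). \<bar>a\<bar> \<le> 1 \<and> \<bar>b\<bar> \<le> 1 \<and> c\<^sup>2 = (1 - a\<^sup>2) * (1 - b\<^sup>2)}"
  then obtain a b c :: real where v: "v = (a, b, c)" and ab: "\<bar>a\<bar> \<le> 1" "\<bar>b\<bar> \<le> 1"
    and c: "c\<^sup>2 = (1 - a\<^sup>2) * (1 - b\<^sup>2)" by auto
  define x y where "x = arccos a / pi" and "y = arccos b / pi"
  have xy: "cos (pi * x) = a" "cos (pi * y) = b" using ab by (auto simp: x_def y_def cos_arccos_abs)
  have "c\<^sup>2 = (sin (pi * x) * sin (pi * y))\<^sup>2"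
    by (simp add: c power_mult_distrib sin_squared_eq xy)
  then consider "c = sin (pi * x) * sin (pi * y)" | "c = - (sin (pi * x) * sin (pi * y))"
    by (auto simp: power2_eq_iff)
  then show "v \<in> pillowcase"
  proof cases
    case 1
    then have "v = pillow (x, y)" by (simp add: v pillow_def xy)
    then show ?thesis by (simp add: pillowcase_def)
  next
    case 2
    then have "v = pillow (- x, y)" by (simp add: v pillow_def xy)
    then show ?thesis by (simp add: pillowcase_def)
  qed
qed

lemma pillow_ball_interior:
  "interior pillow_ball = {(a, b, c). \<bar>a\<bar> < 1 \<and> \<bar>b\<bar> < 1 \<and> c\<^sup>2 < (1 - a\<^sup>2) * (1 - b\<^sup>2)}"
    (is "_ = ?I")
proof
  have "?I = {v. \<bar>fst v\<bar> < 1} \<inter> {v. \<bar>fst (snd v)\<bar> < 1} \<inter>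
      {v. (snd (snd v))\<^sup>2 < (1 - (fst v)\<^sup>2) * (1 - (fst (snd v))\<^sup>2)}"
    by auto
  moreover have "open \<dots>"
    by (intro open_Int open_Collect_less continuous_intros)
  ultimately have "open ?I" by simp
  moreover have "?I \<subseteq> pillow_ball" by (auto simp: pillow_ball_def)
  ultimately show "?I \<subseteq> interior pillow_ball" by (rule interior_maximal[rotated])
next
  show "interior pillow_ball \<subseteq> ?I"
  proof
    fix v assume vi: "v \<in> interior pillow_ball"
    have "isCont (\<lambda>s. s *\<^sub>R v) (1::real)" by (intro continuous_intros)
    then have "((\<lambda>s. s *\<^sub>R v) \<longlongrightarrow> v) (at_right (1::real))"
      by (simp add: isCont_def filterlim_at_split)
    then have "\<forall>\<^sub>F s in at_right (1::real). s *\<^sub>R v \<in> interior pillow_ball"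
      using vi by (auto elim: topological_tendstoD)
    then have "\<forall>\<^sub>F s in at_right (1::real). s *\<^sub>R v \<in> interior pillow_ball \<and> s > 1"
      by (auto intro: eventually_conj eventually_at_right_less)
    then obtain s :: real where s: "s > 1" "s *\<^sub>R v \<in> pillow_ball"
      using eventually_happens'[OF trivial_limit_at_right_real] interior_subset[of pillow_ball] by blast
    obtain a b c where v: "v = (a, b, c)" by (cases v)
    have sab: "\<bar>s * a\<bar> \<le> 1" "\<bar>s * b\<bar> \<le> 1"
      and sc: "(s * c)\<^sup>2 \<le> (1 - (s * a)\<^sup>2) * (1 - (s * b)\<^sup>2)"
      using s by (auto simp: v pillow_ball_def)
    have less: "\<bar>r\<bar> < 1" if "\<bar>s * r\<bar> \<le> 1" for r
    proof (rule ccontr)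
      assume "\<not> \<bar>r\<bar> < 1"
      then have "s * \<bar>r\<bar> \<ge> s * 1" using s by (intro mult_left_mono) auto
      moreover have "s * \<bar>r\<bar> \<le> 1" using that s by (simp add: abs_mult)
      ultimately show False using s(1) by linarith
    qed
    have ab: "\<bar>a\<bar> < 1" "\<bar>b\<bar> < 1" using less sab by auto
    have s2: "s\<^sup>2 > 1" using s by (simp add: one_less_power)
    have le: "1 - (s * r)\<^sup>2 \<le> 1 - r\<^sup>2" for r
      using s2 mult_right_mono[of 1 "s\<^sup>2" "r\<^sup>2"] by (simp add: power_mult_distrib)
    have "(s * c)\<^sup>2 \<le> (1 - a\<^sup>2) * (1 - b\<^sup>2)"
      using sab ab le[of a] le[of b]
      by (intro order.trans[OF sc] mult_mono) (auto simp: abs_square_le_1)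
    moreover have "c\<^sup>2 < (s * c)\<^sup>2" if "c \<noteq> 0"
      using s2 that mult_strict_right_mono[of 1 "s\<^sup>2" "c\<^sup>2"] by (simp add: power_mult_distrib)
    moreover have "0 < (1 - a\<^sup>2) * (1 - b\<^sup>2)"
      using ab by (simp add: abs_square_less_1)
    ultimately have "c\<^sup>2 < (1 - a\<^sup>2) * (1 - b\<^sup>2)" by (cases "c = 0") auto
    then show "v \<in> ?I" using ab by (simp add: v)
  qed
qed

lemma frontier_pillow_ball: "frontier pillow_ball = pillowcase"
proof -
  have "c\<^sup>2 = (1 - a\<^sup>2) * (1 - b\<^sup>2)"
    if "\<bar>a\<bar> \<le> 1" "\<bar>b\<bar> \<le> 1" "c\<^sup>2 \<le> (1 - a\<^sup>2) * (1 - b\<^sup>2)" "\<not> (\<bar>a\<bar> < 1 \<and> \<bar>b\<bar> < 1)" for a b c :: real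
  proof -
    have "\<bar>a\<bar> = 1 \<or> \<bar>b\<bar> = 1" using that by linarith
    then have "a\<^sup>2 = 1 \<or> b\<^sup>2 = 1" by (auto simp: power2_eq_1_iff abs_if split: if_splits)
    then show ?thesis using that(3) by auto
  qed
  then show ?thesis
    unfolding frontier_def closure_closed[OF pillow_ball_closed] pillow_ball_interior pillowcase_eq
    by (fastforce simp: pillow_ball_def)
qed

section \<open>Existence of two-bridge links\<close>

lemma continuous_on_pillow: "continuous_on S pillow"
proof -
  have "pillow = (\<lambda>v. (cos (pi * fst v), cos (pi * snd v), sin (pi * fst v) * sin (pi * snd v)))"
    by (auto simp: pillow_def fun_eq_iff)
  moreover have "continuous_on S \<dots>" by (intro continuous_intros)
  ultimately show ?thesis by metis
qed

lemma pillow_square: "pillow ` ({0..2} \<times> {0..2}) = pillowcase"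
proof -
  have "pillow v \<in> pillow ` ({0..2} \<times> {0..2})" for v
  proof -
    obtain x y where v: "v = (x, y)" by (cases v)
    define x' y' where "x' = x - 2 * of_int \<lfloor>x / 2\<rfloor>" and "y' = y - 2 * of_int \<lfloor>y / 2\<rfloor>"
    have "v = (x', y') + 2 *\<^sub>R (of_int \<lfloor>x / 2\<rfloor>, of_int \<lfloor>y / 2\<rfloor>)"
      by (simp add: v x'_def y'_def)
    then have "pillow v = pillow (x', y')"
      unfolding pillow_eq_iff by blast
    moreover have "x' \<in> {0..2}" "y' \<in> {0..2}"
      unfolding x'_def y'_def
      using floor_correct[of "x / 2"] floor_correct[of "y / 2"] by (simp_all, linarith+)
    ultimately show ?thesis by blast
  qed
  then show ?thesis by (auto simp: pillowcase_def)
qed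

lemma continuous_on_pillowcase:
  fixes h :: "real \<times> real \<times> real \<Rightarrow> 'a::topological_space"
  assumes F: "continuous_on UNIV F" and h: "\<And>v. h (pillow v) = F v"
  shows "continuous_on pillowcase h"
proof -
  have cpt: "compact ({0..2} \<times> {0..2} :: (real \<times> real) set)"
    by (intro compact_Times) auto
  have "closed pillowcase"
    unfolding pillow_square[symmetric]
    by (intro compact_imp_closed compact_continuous_image continuous_on_pillow cpt)
  moreover have "closed (h -` B \<inter> pillowcase)" if "closed B" for B
  proof -
    have "closed (F -` B)"
      using F that by (simp add: continuous_on_closed_vimage)
    then have "compact (({0..2} \<times> {0..2}) \<inter> F -` B)"
      by (rule compact_Int_closed[OF cpt])
    then have "closed (pillow ` (({0..2} \<times> {0..2}) \<inter> F -` B))"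
      by (intro compact_imp_closed compact_continuous_image continuous_on_pillow)
    moreover have "h -` B \<inter> pillowcase = pillow ` (({0..2} \<times> {0..2}) \<inter> F -` B)"
      unfolding pillow_square[symmetric] using h by auto
    ultimately show ?thesis by simp
  qed
  ultimately show ?thesis by (simp add: continuous_on_closed_vimage)
qed

definition int_matrix_map :: "int \<Rightarrow> int \<Rightarrow> int \<Rightarrow> int \<Rightarrow> real \<times> real \<Rightarrow> real \<times> real"
  where "int_matrix_map a b c d v =
    (of_int a * fst v + of_int b * snd v, of_int c * fst v + of_int d * snd v)"

lemma linear_int_matrix_map: "linear (int_matrix_map a b c d)"
  by (rule linearI) (auto simp: int_matrix_map_def algebra_simps)

lemma int_matrix_map_pillow:
  assumes "pillow v = pillow w"
  shows "pillow (int_matrix_map a b c d v) = pillow (int_matrix_map a b c d w)"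
proof -
  let ?M = "int_matrix_map a b c d"
  from assms obtain m n :: int where
    "v = w + 2 *\<^sub>R (of_int m, of_int n) \<or> v = 2 *\<^sub>R (of_int m, of_int n) - w"
    unfolding pillow_eq_iff by blast
  then have "?M v = ?M w + 2 *\<^sub>R ?M (of_int m, of_int n) \<or> ?M v = 2 *\<^sub>R ?M (of_int m, of_int n) - ?M w"
    using linear_add[OF linear_int_matrix_map] linear_diff[OF linear_int_matrix_map]
      linear_scale[OF linear_int_matrix_map] by metis
  moreover have "?M (of_int m, of_int n) = (of_int (a * m + b * n), of_int (c * m + d * n))"
    by (simp add: int_matrix_map_def)
  ultimately show ?thesis unfolding pillow_eq_iff by metis
qed

definition int_matrix_pillow ::
    "int \<Rightarrow> int \<Rightarrow> int \<Rightarrow> int \<Rightarrow> real \<times> real \<times> real \<Rightarrow> real \<times> real \<times> real"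
  where "int_matrix_pillow a b c d z = pillow (int_matrix_map a b c d (inv pillow z))"

lemma int_matrix_pillow: "int_matrix_pillow a b c d (pillow v) = pillow (int_matrix_map a b c d v)"
  unfolding int_matrix_pillow_def
  by (rule int_matrix_map_pillow) (simp add: f_inv_into_f)

lemma continuous_on_int_matrix_pillow: "continuous_on pillowcase (int_matrix_pillow a b c d)"
proof (rule continuous_on_pillowcase)
  show "continuous_on UNIV (\<lambda>v. pillow (int_matrix_map a b c d v))"
    by (intro continuous_on_compose2[OF continuous_on_pillow[of UNIV]]
        linear_continuous_on linear_linear[THEN iffD2] linear_int_matrix_map subset_UNIV)
qed (rule int_matrix_pillow)

lemma two_bridge_gluing_exists:
  assumes "coprime p q"
  shows "\<exists>h. two_bridge_gluing p q h"
proof -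
  obtain r s0 :: int where "r * p + s0 * q = gcd p q"
    using bezout_int[of p q] by blast
  then have det: "r * p - q * (- s0) = 1"
    using assms by (simp add: algebra_simps)
  define s where "s = - s0"
  have det': "r * p - q * s = 1" using det by (simp add: s_def)
  then have rdet: "real_of_int r * of_int p - of_int q * of_int s = 1"
    by (metis of_int_1 of_int_diff of_int_mult)
  let ?A = "int_matrix_map r q s p" and ?D = "int_matrix_map p (- q) (- s) r"
  let ?h = "int_matrix_pillow r q s p" and ?g = "int_matrix_pillow p (- q) (- s) r"
  have AD: "?A (?D v) = v" for v
  proof -
    have "?A (?D v) = ((of_int r * of_int p - of_int q * of_int s) *\<^sub>R v)"
      by (cases v) (simp add: int_matrix_map_def algebra_simps)
    then show ?thesis using rdet by simp
  qed
  have DA: "?D (?A v) = v" for v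
  proof -
    have "?D (?A v) = ((of_int r * of_int p - of_int q * of_int s) *\<^sub>R v)"
      by (cases v) (simp add: int_matrix_map_def algebra_simps)
    then show ?thesis using rdet by simp
  qed
  have gh: "?g (?h z) = z" "?h (?g z) = z" "?h z \<in> pillowcase" "?g z \<in> pillowcase" if "z \<in> pillowcase" for z
    using that by (auto simp: pillowcase_def int_matrix_pillow AD DA)
  have "homeomorphism pillowcase pillowcase ?h ?g"
    using gh by (intro homeomorphismI continuous_on_int_matrix_pillow) auto
  moreover have "?h ` marked_points = marked_points"
  proof -
    have "int_matrix_map a b c d v \<in> \<int> \<times> \<int>" if "v \<in> \<int> \<times> \<int>" for a b c d v
      using that by (auto simp: int_matrix_map_def)
    then have 1: "?A ` (\<int> \<times> \<int>) \<subseteq> \<int> \<times> \<int>" and 2: "?D ` (\<int> \<times> \<int>) \<subseteq> \<int> \<times> \<int>"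
      by blast+
    have "?A ` (\<int> \<times> \<int>) = \<int> \<times> \<int>"
    proof (rule equalityI[OF 1])
      show "\<int> \<times> \<int> \<subseteq> ?A ` (\<int> \<times> \<int>)"
        using image_mono[OF 2, of ?A] unfolding image_image AD by simp
    qed
    moreover have "?h ` marked_points = pillow ` ?A ` (\<int> \<times> \<int>)"
      by (simp add: marked_points_def image_image int_matrix_pillow)
    ultimately show ?thesis
      by (simp add: marked_points_def)
  qed
  moreover have "?h ` slope_arcs 1 0 = slope_arcs p q"
  proof (intro equalityI subsetI)
    fix z assume "z \<in> ?h ` slope_arcs 1 0"
    then obtain m n :: int and t :: real where
      "z = ?h (pillow (of_int m + t * of_int 0, of_int n + t * of_int 1))"
      by (auto simp: slope_arcs_def)
    then have "z = pillow (of_int (r * m + q * n) + t * of_int q, of_int (s * m + p * n) + t * of_int p)"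
      by (simp add: int_matrix_pillow int_matrix_map_def algebra_simps)
    then show "z \<in> slope_arcs p q"
      unfolding slope_arcs_def by blast
  next
    fix z assume "z \<in> slope_arcs p q"
    then obtain m n :: int and t :: real where
      z: "z = pillow (of_int m + t * of_int q, of_int n + t * of_int p)"
      by (auto simp: slope_arcs_def)
    have "?D (of_int m + t * of_int q, of_int n + t * of_int p) =
        (of_int (p * m - q * n), of_int (- s * m + r * n) + t * (of_int r * of_int p - of_int q * of_int s))"
      by (simp add: int_matrix_map_def algebra_simps)
    also have "\<dots> = (of_int (p * m - q * n) + t * of_int 0, of_int (- s * m + r * n) + t * of_int 1)"
      using rdet by simp
    finally have "z = ?h (pillow (of_int (p * m - q * n) + t * of_int 0, of_int (- s * m + r * n) + t * of_int 1))"
      using z by (metis AD int_matrix_pillow)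
    then show "z \<in> ?h ` slope_arcs 1 0"
      unfolding slope_arcs_def by blast
  qed
  moreover have "\<exists>A. linear A \<and> (\<forall>v. ?h (pillow v) = pillow (A v))"
    using linear_int_matrix_map[of r q s p] int_matrix_pillow[of r q s p] by metis
  ultimately have "two_bridge_gluing p q ?h"
    unfolding two_bridge_gluing_def by (intro conjI exI[of _ ?g])
  then show ?thesis by (rule exI[where x = "?h"])
qed

lemma cone_extension:
  fixes h :: "'a::euclidean_space \<Rightarrow> 'a"
  assumes cont: "continuous_on (sphere 0 1) h" and bij: "bij_betw h (sphere 0 1) (sphere 0 1)"
  defines "H \<equiv> \<lambda>x. norm x *\<^sub>R h (x /\<^sub>R norm x)"
  shows "continuous_on (cball 0 1) H" "bij_betw H (cball 0 1) (cball 0 1)"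
    "\<And>x. norm x = 1 \<Longrightarrow> H x = h x" "\<And>x. norm (H x) = norm x"
proof -
  have h1: "norm (h x) = 1" if "norm x = 1" for x
    using bij that by (auto simp: bij_betw_def)
  have n1: "norm (x /\<^sub>R norm x) = 1" if "x \<noteq> 0" for x :: 'a
    using that by simp
  show H1: "H x = h x" if "norm x = 1" for x using that by (simp add: H_def)
  show nH: "norm (H x) = norm x" for x
  proof (cases "x = 0")
    case False
    then show ?thesis using h1[OF n1[OF False]] by (simp add: H_def)
  qed (simp add: H_def)
  have c0: "continuous_on (- {0}) H"
    unfolding H_def
    by (intro continuous_intros continuous_on_compose2[OF cont]) (auto simp: field_simps split: if_splits)
  have "isCont H x" for x
  proof (cases "x = 0")
    case True
    have "((\<lambda>x. norm (H x)) \<longlongrightarrow> 0) (at 0)"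
      unfolding nH by (intro tendsto_norm_zero) simp
    then have "(H \<longlongrightarrow> 0) (at 0)" by (rule tendsto_norm_zero_cancel)
    then show ?thesis using True by (simp add: isCont_def H_def)
  next
    case False
    moreover have "open (- {0 :: 'a})" by auto
    ultimately show ?thesis using c0 by (simp add: continuous_on_eq_continuous_at)
  qed
  then show "continuous_on (cball 0 1) H"
    by (simp add: continuous_at_imp_continuous_on)
  show "bij_betw H (cball 0 1) (cball 0 1)"
    unfolding bij_betw_def
  proof
    show "inj_on H (cball 0 1)"
    proof (rule inj_onI)
      fix x y assume eq: "H x = H y"
      then have n: "norm x = norm y" by (metis nH)
      show "x = y"
      proof (cases "x = 0")
        case False
        then have y: "y \<noteq> 0" using n by auto
        have "h (x /\<^sub>R norm x) = h (y /\<^sub>R norm y)"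
          using eq n False y by (simp add: H_def)
        then have "x /\<^sub>R norm x = y /\<^sub>R norm y"
          using bij n1[OF False] n1[OF y] by (auto simp: bij_betw_def dest!: inj_onD)
        then show ?thesis using n y by simp
      qed (use n in auto)
    qed
    show "H ` cball 0 1 = cball 0 1"
    proof
      show "H ` cball 0 1 \<subseteq> cball 0 1" using nH by auto
      show "cball 0 1 \<subseteq> H ` cball 0 1"
      proof
        fix y :: 'a assume y: "y \<in> cball 0 1"
        show "y \<in> H ` cball 0 1"
        proof (cases "y = 0")
          case True
          then show ?thesis by (intro image_eqI[of _ _ 0]) (auto simp: H_def)
        next
          case False
          then have "y /\<^sub>R norm y \<in> h ` sphere 0 1"
            using bij n1[OF False] by (auto simp: bij_betw_def)
          then obtain u where u: "norm u = 1" "y /\<^sub>R norm y = h u" by auto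
          have "H (norm y *\<^sub>R u) = y"
            using u False by (simp add: H_def flip: u(2))
          moreover have "norm y *\<^sub>R u \<in> cball 0 1" using y u by simp
          ultimately show ?thesis by (metis image_eqI)
        qed
      qed
    qed
  qed
qed

definition hemisphere :: "real \<Rightarrow> real \<times> real \<times> real \<Rightarrow> real^4"
  where "hemisphere \<sigma> v =
    vector [fst v, fst (snd v), snd (snd v), \<sigma> * sqrt (1 - (norm v)\<^sup>2)]"

lemma norm_hemisphere_args:
  "(norm v)\<^sup>2 = (fst v)\<^sup>2 + ((fst (snd v))\<^sup>2 + (snd (snd v))\<^sup>2)" for v :: "real \<times> real \<times> real"
  by (cases v) (simp add: norm_Pair)

lemma sphere4_iff:
  "x \<in> sphere (0::real^4) 1 \<longleftrightarrow> (x$1)\<^sup>2 + (x$2)\<^sup>2 + (x$3)\<^sup>2 + (x$4)\<^sup>2 = 1"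
  by (simp add: norm_eq_1 inner_vec_def sum_4 power2_eq_square)

lemma vector_4_sel:
  "(vector [a, b, c, d] :: 'a::zero^4) $ 1 = a" "(vector [a, b, c, d] :: 'a^4) $ 2 = b"
  "(vector [a, b, c, d] :: 'a^4) $ 3 = c" "(vector [a, b, c, d] :: 'a^4) $ 4 = d"
  by (simp_all add: vector_def)

lemma hemisphere_image:
  assumes "\<bar>\<sigma>\<bar> = 1"
  shows "hemisphere \<sigma> ` cball 0 1 = {x \<in> sphere 0 1. 0 \<le> \<sigma> * x $ 4}"
proof -
  have s: "\<sigma> * \<sigma> = 1" using assms by (auto simp: abs_if split: if_splits)
  show ?thesis
  proof (intro equalityI subsetI)
    fix x assume "x \<in> hemisphere \<sigma> ` cball 0 1"
    then obtain v where v: "norm v \<le> 1" "x = hemisphere \<sigma> v" by auto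
    have nv: "(norm v)\<^sup>2 \<le> 1" using v by (simp add: abs_square_le_1)
    have "\<sigma>\<^sup>2 = 1" using s by (simp add: power2_eq_square)
    then have "x \<in> sphere 0 1"
      using nv unfolding v(2) sphere4_iff hemisphere_def vector_4_sel
      by (simp add: power_mult_distrib norm_hemisphere_args)
    moreover have "0 \<le> \<sigma> * x $ 4"
      unfolding v(2) hemisphere_def vector_4_sel using nv s by (simp flip: mult.assoc)
    ultimately show "x \<in> {x \<in> sphere 0 1. 0 \<le> \<sigma> * x $ 4}" by simp
  next
    fix x :: "real^4" assume "x \<in> {x \<in> sphere 0 1. 0 \<le> \<sigma> * x $ 4}"
    then have x: "(x$1)\<^sup>2 + (x$2)\<^sup>2 + (x$3)\<^sup>2 + (x$4)\<^sup>2 = 1" "0 \<le> \<sigma> * x $ 4"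
      by (auto simp only: sphere4_iff mem_Collect_eq)
    define v where "v = (x$1, x$2, x$3)"
    have nv: "1 - (norm v)\<^sup>2 = (x$4)\<^sup>2" using x(1) by (simp add: norm_hemisphere_args v_def)
    have "\<bar>x$4\<bar> = \<sigma> * x$4" using x(2) assms by (metis abs_mult abs_of_nonneg mult_1)
    then have "\<sigma> * sqrt (1 - (norm v)\<^sup>2) = x$4"
      unfolding nv using s by (simp flip: mult.assoc)
    then have "x = hemisphere \<sigma> v"
      by (simp add: hemisphere_def vec_eq_iff forall_4 vector_4_sel v_def)
    moreover have "(norm v)\<^sup>2 \<le> 1" using nv zero_le_power2[of "x$4"] by linarith
    then have "v \<in> cball 0 1" by (simp add: abs_square_le_1)
    ultimately show "x \<in> hemisphere \<sigma> ` cball 0 1" by blast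
  qed
qed

lemma inj_hemisphere: "inj (hemisphere \<sigma>)"
  by (rule injI) (auto simp: hemisphere_def vec_eq_iff forall_4 vector_4_sel prod_eq_iff)

lemma continuous_on_hemisphere: "continuous_on S (hemisphere \<sigma>)"
proof -
  have "continuous_on S (\<lambda>v. hemisphere \<sigma> v $ i)" for i
  proof -
    consider "i = 1" | "i = 2" | "i = 3" | "i = 4" using exhaust_4[of i] by blast
    then show ?thesis
      by cases (simp_all only: hemisphere_def vector_4_sel, (intro continuous_intros)+)
  qed
  then have "continuous_on S (\<lambda>v. \<chi> i. hemisphere \<sigma> v $ i)"
    by (rule continuous_on_vec_lambda)
  then show ?thesis by simp
qed

lemma hemisphere_equator: "norm v = 1 \<Longrightarrow> hemisphere \<sigma> v = hemisphere \<tau> v"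
  by (simp add: hemisphere_def)

lemma two_bridge_exists:
  assumes "coprime p q"
  shows "\<exists>K. two_bridge p q K"
proof -
  obtain h where glue: "two_bridge_gluing p q h"
    using two_bridge_gluing_exists[OF assms] by blast
  then obtain g where hg: "homeomorphism pillowcase pillowcase h g"
    by (auto simp: two_bridge_gluing_def)
  have "(0, 0, 0) \<in> interior pillow_ball" by (simp add: pillow_ball_interior)
  then have ne: "interior pillow_ball \<noteq> {}" by blast
  have "pillow_ball homeomorphic cball (0 :: real \<times> real \<times> real) 1"
    using ne by (intro homeomorphic_convex_compact pillow_ball_convex pillow_ball_compact) auto
  then obtain j k where jk: "homeomorphism pillow_ball (cball (0 :: real \<times> real \<times> real) 1) j k"
    unfolding homeomorphic_def by blast
  have j_inj: "inj_on j pillow_ball" and k_inj: "inj_on k (cball 0 1)"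
    using jk by (auto simp: homeomorphism_def intro: inj_on_inverseI)
  have j_im: "j ` pillow_ball = cball 0 1" and k_im: "k ` cball 0 1 = pillow_ball"
    and jc: "continuous_on pillow_ball j" and kc: "continuous_on (cball 0 1) k"
    and kj: "\<And>x. x \<in> pillow_ball \<Longrightarrow> k (j x) = x" and jk': "\<And>y. y \<in> cball 0 1 \<Longrightarrow> j (k y) = y"
    using jk by (auto simp: homeomorphism_def)
  have ji: "j \<in> interior pillow_ball \<rightarrow> interior (cball 0 1)"
    using continuous_image_subset_interior[OF jc j_inj] by (simp add: j_im)
  have ki: "k \<in> interior (cball 0 1) \<rightarrow> interior pillow_ball"
    using continuous_image_subset_interior[OF kc k_inj] by (simp add: k_im)
  have case_diff: "pillowcase = pillow_ball - interior pillow_ball"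
    by (simp add: frontier_def pillow_ball_closed flip: frontier_pillow_ball)
  have sphere_diff: "sphere 0 1 = cball (0 :: real \<times> real \<times> real) 1 - interior (cball 0 1)"
    by auto
  have j_case: "j x \<in> sphere 0 1" if "x \<in> pillowcase" for x
    using that ki kj j_im unfolding case_diff sphere_diff by (metis Diff_iff PiE image_eqI)
  have k_sphere: "k y \<in> pillowcase" if "y \<in> sphere 0 1" for y
    using that ji jk' k_im unfolding case_diff sphere_diff by (metis Diff_iff PiE image_eqI)
  have sub: "pillowcase \<subseteq> pillow_ball" "sphere (0 :: real \<times> real \<times> real) 1 \<subseteq> cball 0 1"
    by (auto simp: case_diff)
  have j_case_im: "j ` pillowcase = sphere 0 1"
  proof
    show "j ` pillowcase \<subseteq> sphere 0 1" using j_case by blast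
    show "sphere 0 1 \<subseteq> j ` pillowcase"
    proof
      fix y :: "real \<times> real \<times> real" assume y: "y \<in> sphere 0 1"
      then have "y = j (k y)" using jk' sub(2) by fastforce
      then show "y \<in> j ` pillowcase" using k_sphere[OF y] by blast
    qed
  qed
  have g: "g x \<in> pillowcase" "h x \<in> pillowcase" "g (h x) = x" "h (g x) = x" if "x \<in> pillowcase" for x
    using homeomorphism_image1[OF hg] homeomorphism_image2[OF hg] homeomorphism_apply1[OF hg that]
      homeomorphism_apply2[OF hg that] that by blast+
  define h1 where "h1 = (\<lambda>y. j (g (k y)))"
  have h1c: "continuous_on (sphere 0 1) h1"
    unfolding h1_def
  proof (rule continuous_on_compose2[OF jc])
    show "continuous_on (sphere 0 1) (\<lambda>y. g (k y))"
      by (rule continuous_on_compose2[OF homeomorphism_cont2[OF hg] continuous_on_subset[OF kc sub(2)]])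
        (use k_sphere in blast)
    show "(\<lambda>y. g (k y)) ` sphere 0 1 \<subseteq> pillow_ball"
      using k_sphere g sub by blast
  qed
  have h1b: "bij_betw h1 (sphere 0 1) (sphere 0 1)"
  proof (rule bij_betwI[where g = "\<lambda>y. j (h (k y))"])
    show "h1 \<in> sphere 0 1 \<rightarrow> sphere 0 1" "(\<lambda>y. j (h (k y))) \<in> sphere 0 1 \<rightarrow> sphere 0 1"
      unfolding h1_def using k_sphere g j_case by blast+
    fix y :: "real \<times> real \<times> real" assume y: "y \<in> sphere 0 1"
    have "k (j (g (k y))) = g (k y)" "k (j (h (k y))) = h (k y)"
      using kj k_sphere[OF y] g sub by blast+
    then show "j (h (k (h1 y))) = y" "h1 (j (h (k y))) = y"
      unfolding h1_def using g[OF k_sphere[OF y]] jk' y sub(2) by auto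
  qed
  define H where "H = (\<lambda>x. norm x *\<^sub>R h1 (x /\<^sub>R norm x))"
  note H = cone_extension[OF h1c h1b, folded H_def]
  have Hi: "H ` cball 0 1 = cball 0 1" "inj_on H (cball 0 1)"
    using H(2) unfolding bij_betw_def by blast+
  define f where "f = (\<lambda>x. hemisphere 1 (j x))"
  define f' where "f' = (\<lambda>x. hemisphere (- 1) (H (j x)))"
  have fim: "f ` pillow_ball = {x \<in> sphere 0 1. 0 \<le> x $ 4}"
  proof -
    have "f ` pillow_ball = hemisphere 1 ` j ` pillow_ball"
      by (simp add: f_def image_image)
    then show ?thesis
      using hemisphere_image[of 1] by (simp add: j_im)
  qed
  have "f' ` pillow_ball = hemisphere (- 1) ` H ` j ` pillow_ball"
    by (simp add: f'_def image_image)
  then have f'im: "f' ` pillow_ball = {x \<in> sphere 0 1. x $ 4 \<le> 0}"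
    using hemisphere_image[of "- 1"] by (simp add: j_im Hi)
  have f_case: "f ` pillowcase = {x \<in> sphere 0 1. x $ 4 = 0}"
  proof -
    have "f ` pillowcase = hemisphere 1 ` sphere 0 1"
      unfolding f_def j_case_im[symmetric] by (simp add: image_image)
    also have "\<dots> = {x \<in> hemisphere 1 ` cball 0 1. x $ 4 = 0}"
    proof -
      have "hemisphere 1 v $ 4 = 0 \<longleftrightarrow> norm v = 1" for v
      proof -
        have "hemisphere 1 v $ 4 = 0 \<longleftrightarrow> (norm v)\<^sup>2 = 1"
          by (auto simp: hemisphere_def vector_4_sel)
        then show ?thesis
          by (metis norm_ge_zero power2_eq_1_iff one_power2 abs_norm_cancel abs_neg_one)
      qed
      then show ?thesis by auto
    qed
    also have "\<dots> = {x \<in> sphere 0 1. x $ 4 = 0}"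
      using hemisphere_image[of 1] by auto
    finally show ?thesis .
  qed
  have "continuous_on pillow_ball f"
    unfolding f_def
    by (rule continuous_on_compose2[OF continuous_on_hemisphere[of UNIV] jc]) simp
  moreover have "inj_on f pillow_ball"
    unfolding f_def by (rule inj_onI) (use j_inj inj_hemisphere in \<open>blast dest: inj_onD injD\<close>)
  moreover have "continuous_on pillow_ball f'"
    unfolding f'_def
    by (rule continuous_on_compose2[OF continuous_on_hemisphere[of UNIV]
          continuous_on_compose2[OF H(1) jc]]) (auto simp: j_im)
  moreover have "inj_on f' pillow_ball"
    unfolding f'_def
  proof (rule inj_onI)
    fix x y assume x: "x \<in> pillow_ball" and y: "y \<in> pillow_ball"
      and eq: "hemisphere (- 1) (H (j x)) = hemisphere (- 1) (H (j y))"
    then have "H (j x) = H (j y)" by (rule_tac injD[OF inj_hemisphere])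
    moreover have "j x \<in> cball 0 1" "j y \<in> cball 0 1" using x y j_im by blast+
    ultimately have "j x = j y" by (rule inj_onD[OF Hi(2)])
    then show "x = y" using inj_onD[OF j_inj] x y by blast
  qed
  moreover have "f ` pillow_ball \<union> f' ` pillow_ball = sphere 0 1"
    unfolding fim f'im by auto
  moreover have "f ` pillow_ball \<inter> f' ` pillow_ball = f ` pillowcase"
    unfolding fim f'im f_case by auto
  moreover have "f x = f' (h x)" if x: "x \<in> pillowcase" for x
  proof -
    have "j (h x) \<in> sphere 0 1" using j_case g x by blast
    then have "H (j (h x)) = h1 (j (h x))" by (simp add: H_def)
    also have "\<dots> = j x"
    proof -
      have "k (j (h x)) = h x" using kj g(2)[OF x] sub(1) by blast
      then show ?thesis by (simp add: h1_def g(3)[OF x])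
    qed
    finally show ?thesis
      unfolding f_def f'_def using j_case[OF x] hemisphere_equator by auto
  qed
  ultimately have "two_bridge p q (f ` vertical_arcs \<union> f' ` vertical_arcs)"
    unfolding two_bridge_def using glue by blast
  then show ?thesis by blast
qed

end

theory Submission
  imports Defs
begin

text \<open>
  The double cover of the sphere branched over a two-bridge link with parameter \<open>p/q\<close>,
  \<open>q \<noteq> 0\<close>, is a lens space whose universal cover is the three-sphere. Composing the two
  coverings exhibits the sphere containing \<open>K\<close> as the quotient of the round three-sphere by a
  dihedral group of order \<open>2 |q|\<close> acting by isometries. In \<open>\<complex>\<^sup>2\<close> it consists of the maps
  \<open>(z, w) \<mapsto> (\<alpha> z, \<beta> w)\<close> and \<open>(z, w) \<mapsto> (\<alpha> cnj z, \<beta> cnj w)\<close>, where \<open>\<alpha>\<close> runs through the solutions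
  of \<open>\<alpha> ^ |q| = 1\<close> and \<open>\<beta>\<close> is a fixed power of \<open>\<alpha>\<close> that in turn determines \<open>\<alpha>\<close>. The rotations
  other than the identity have no fixed points on the sphere, while each conjugate-linear map
  fixes exactly one great circle, and these circles are disjoint. Their union is the preimage of
  \<open>K\<close>, and off this union the action is free, so that the quotient map is a covering there.

  The link is only known up to homeomorphism, as the union of two abstractly glued balls, so the
  quotient map has to be built ball by ball. The Clifford torus \<open>|z| = |w|\<close> splits the sphere into
  two solid tori. Dividing such a torus by its cyclic rotation group gives again a solid torus,
  with quotient map \<open>(u, v) \<mapsto> (u\<^sup>m, u\<^sup>n v)\<close> on \<open>S\<^sup>1 \<times> D\<^sup>2\<close>. Dividing further by complex conjugation gives
  the ball, by the polynomial map \<open>torus_fold\<close>, which restricts to \<open>pillow\<close> on the boundary torus and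
  takes the fixed points of the conjugation onto the two vertical arcs. In the angular coordinates
  of the Clifford torus both composites are linear maps followed by \<open>pillow\<close>. The gluing map is
  linear too, and \<open>two_bridge_gluing_lens\<close> chooses the exponents \<open>m\<close> and \<open>n\<close> so that the two halves agree
  on the torus. The choice forces \<open>|m| = |q|\<close> and \<open>p n \<equiv> 1\<close> modulo \<open>m\<close>, which is precisely the
  condition under which the two halves are quotients by the same group (\<open>lens_group_swap\<close>).
\<close>

section \<open>Finite coverings from free actions\<close>

lemma finite_imp_uniform_discrete: "finite S \<Longrightarrow> uniform_discrete S"
  by (induction S rule: finite_induct) (simp_all add: uniform_discrete_insert)

text \<open>
  Since the map is closed, a small neighbourhood of \<open>x\<close> has its whole preimage inside given disjoint
  neighbourhoods of the finitely many points over \<open>x\<close>. Local injectivity and the constant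
  cardinality of the fibres then make each of these neighbourhoods a sheet.
\<close>

lemma finite_sheeted_covering_closed_map:
  fixes c :: "'a::metric_space \<Rightarrow> 'b::topological_space"
  assumes cont: "continuous_on E c" and img: "c ` E = X"
    and closed_map: "\<And>C. closedin (top_of_set E) C \<Longrightarrow> closedin (top_of_set X) (c ` C)"
    and loc_inj: "\<And>e. e \<in> E \<Longrightarrow> \<exists>U. openin (top_of_set E) U \<and> e \<in> U \<and> inj_on c U"
    and fin: "\<And>x. x \<in> X \<Longrightarrow> finite {e \<in> E. c e = x}"
    and card: "\<And>x. x \<in> X \<Longrightarrow> card {e \<in> E. c e = x} = n"
  shows "finite_sheeted_covering E c X"
proof -
  have "covering_space E c X"
  proof
    show "continuous_on E c" "c ` E = X" by fact+
    fix x assume x: "x \<in> X"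
    define F where "F = {e \<in> E. c e = x}"
    obtain d where d: "d > 0" "\<And>e e'. e \<in> F \<Longrightarrow> e' \<in> F \<Longrightarrow> dist e e' < d \<Longrightarrow> e = e'"
    proof -
      have "uniform_discrete F"
        unfolding F_def by (rule finite_imp_uniform_discrete[OF fin[OF x]])
      then show ?thesis using that unfolding uniform_discrete_def by blast
    qed
    have "\<forall>e\<in>F. \<exists>U. openin (top_of_set E) U \<and> e \<in> U \<and> inj_on c U"
      using loc_inj by (auto simp: F_def)
    then obtain U where U: "\<And>e. e \<in> F \<Longrightarrow> openin (top_of_set E) (U e)"
      "\<And>e. e \<in> F \<Longrightarrow> e \<in> U e" "\<And>e. e \<in> F \<Longrightarrow> inj_on c (U e)"
      by metis
    define N where "N e = U e \<inter> ball e (d / 2)" for e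
    have N_open: "openin (top_of_set E) (N e)" if "e \<in> F" for e
      unfolding N_def using U(1)[OF that] by (rule openin_Int_open) simp
    have N_self: "e \<in> N e" if "e \<in> F" for e
      using U(2)[OF that] d(1) by (simp add: N_def)
    have N_inj: "inj_on c (N e)" if "e \<in> F" for e
      using U(3)[OF that] by (auto simp: N_def intro: inj_on_subset)
    have N_disj: "e = e'" if "e \<in> F" "e' \<in> F" "y \<in> N e" "y \<in> N e'" for e e' y
    proof (rule d(2)[OF that(1,2)])
      have "dist e y < d / 2" "dist e' y < d / 2" using that by (auto simp: N_def)
      then show "dist e e' < d" using dist_triangle2[of e e' y] by linarith
    qed
    define V where "V = X - c ` (E - \<Union>(N ` F))"
    have "openin (top_of_set E) (\<Union>(N ` F))" using N_open by auto
    then have "closedin (top_of_set E) (E - \<Union>(N ` F))"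
      by (intro closedin_diff) auto
    then have V_open: "openin (top_of_set X) V"
      unfolding V_def by (intro openin_diff closed_map) auto
    have xV: "x \<in> V"
      using x N_self by (auto simp: V_def F_def)
    define P where "P e = N e \<inter> (E \<inter> c -` V)" for e
    have pre_open: "openin (top_of_set E) (E \<inter> c -` V)"
      using continuous_openin_preimage[OF cont _ V_open] img by auto
    have P_open: "openin (top_of_set E) (P e)" if "e \<in> F" for e
      unfolding P_def by (intro openin_Int N_open that pre_open)
    have cover: "\<exists>e\<in>F. y \<in> N e" if "y \<in> E" "c y \<in> V" for y
      using that unfolding V_def by blast
    have P_union: "\<Union>(P ` F) = E \<inter> c -` V"
      using cover by (auto simp: P_def)
    have P_disj: "e = e'" if "e \<in> F" "e' \<in> F" "y \<in> P e" "y \<in> P e'" for e e' y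
      using N_disj that by (auto simp: P_def)
    \<comment> \<open>Each sheet meets a fibre over \<open>V\<close> at most once and the sheets exhaust that fibre, which has
      as many points as there are sheets; so each sheet meets it exactly once.\<close>
    have P_img: "c ` P e = V" if e: "e \<in> F" for e
    proof
      show "c ` P e \<subseteq> V" by (auto simp: P_def)
      show "V \<subseteq> c ` P e"
      proof
        fix y assume y: "y \<in> V"
        then have yX: "y \<in> X" by (simp add: V_def)
        define Fy where "Fy = {e \<in> E. c e = y}"
        have "\<forall>e'\<in>Fy. \<exists>e\<in>F. e' \<in> N e" using cover y by (auto simp: Fy_def)
        then obtain k where k: "\<And>e'. e' \<in> Fy \<Longrightarrow> k e' \<in> F \<and> e' \<in> N (k e')" by metis
        have "inj_on k Fy"
        proof (rule inj_onI)
          fix a b assume ab: "a \<in> Fy" "b \<in> Fy" "k a = k b"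
          then have "a \<in> N (k a)" "b \<in> N (k a)" "c a = c b"
            using k[of a] k[of b] by (auto simp: Fy_def)
          then show "a = b" using N_inj[of "k a"] k[OF ab(1)] by (auto dest: inj_onD)
        qed
        then have "card (k ` Fy) = card F"
          using card[OF x] card[OF yX] by (simp add: card_image Fy_def F_def)
        moreover have "k ` Fy \<subseteq> F" using k by blast
        moreover have "finite F" using fin[OF x] by (simp add: F_def)
        ultimately have "k ` Fy = F" by (intro card_subset_eq) auto
        then obtain e' where "e' \<in> Fy" "k e' = e" using e by blast
        then have "e' \<in> P e" "c e' = y" using k[of e'] y by (auto simp: P_def Fy_def)
        then show "y \<in> c ` P e" by blast
      qed
    qed
    have "\<exists>q. homeomorphism (P e) V c q" if e: "e \<in> F" for e
    proof -
      have "closedin (top_of_set V) (c ` C)" if C: "closedin (top_of_set (P e)) C" for C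
      proof -
        have "P e = (E \<inter> c -` V) - \<Union>(P ` (F - {e}))"
          using P_union P_disj[OF e] e by blast
        moreover have "openin (top_of_set (E \<inter> c -` V)) (\<Union>(P ` (F - {e})))"
        proof (intro openin_Union ballI)
          fix Q assume "Q \<in> P ` (F - {e})"
          then obtain e' where "e' \<in> F" "Q = P e'" by blast
          then show "openin (top_of_set (E \<inter> c -` V)) Q"
            using openin_subset_trans[OF P_open, of e' "E \<inter> c -` V"] P_union by blast
        qed
        ultimately have "closedin (top_of_set (E \<inter> c -` V)) (P e)"
          by (metis closedin_diff closedin_topspace topspace_euclidean_subtopology)
        then have "closedin (top_of_set (E \<inter> c -` V)) C"
          using C by (rule closedin_trans[rotated])
        then obtain D where D: "closed D" "C = (E \<inter> c -` V) \<inter> D"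
          by (auto simp: closedin_closed)
        have "closedin (top_of_set X) (c ` (E \<inter> D))"
          using D(1) by (intro closed_map) (rule closedin_closed_Int)
        then have "closedin (top_of_set V) (V \<inter> c ` (E \<inter> D))"
          by (metis V_open closedin_subtopology_Int_closed inf.absorb_iff2 openin_imp_subset subtopology_subtopology)
        moreover have "c ` C = V \<inter> c ` (E \<inter> D)" using D(2) by auto
        ultimately show ?thesis by simp
      qed
      moreover have "inj_on c (P e)"
        using N_inj[OF e] by (auto simp: P_def intro: inj_on_subset)
      moreover have "continuous_on (P e) c"
        using cont by (rule continuous_on_subset) (auto simp: P_def)
      ultimately show ?thesis
        using homeomorphism_injective_closed_map[of "P e" c V] P_img[OF e] by metis
    qed
    then show "\<exists>T. x \<in> T \<and> openin (top_of_set X) T \<and>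
        (\<exists>v. \<Union>v = E \<inter> c -` T \<and> (\<forall>u\<in>v. openin (top_of_set E) u) \<and>
          pairwise disjnt v \<and> (\<forall>u\<in>v. \<exists>q. homeomorphism u T c q))"
      using xV V_open P_union P_open P_disj
      by (intro exI[of _ V] conjI exI[of _ "P ` F"])
        (auto simp: pairwise_def disjnt_def, blast+)
  qed
  then show ?thesis using fin card unfolding finite_sheeted_covering_def by blast
qed

text \<open>
  By freeness every fibre is in bijection with \<open>G\<close>. For the local injectivity near \<open>e\<close>, separate the
  finitely many points of the orbit of \<open>e\<close> by balls: a map that does not fix \<open>e\<close> takes points near \<open>e\<close>
  into another ball, so two points near \<open>e\<close> with the same image under \<open>c\<close> can only be related by the
  map that fixes \<open>e\<close>, and this map fixes all points nearby.
\<close>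

lemma finite_sheeted_covering_free_action:
  fixes c :: "'a::metric_space \<Rightarrow> 'b::topological_space"
  assumes cont: "continuous_on E c" and img: "c ` E = X"
    and closed_map: "\<And>C. closedin (top_of_set E) C \<Longrightarrow> closedin (top_of_set X) (c ` C)"
    and fin: "finite G"
    and act: "\<And>g. g \<in> G \<Longrightarrow> continuous_on E (act g)" "\<And>g. g \<in> G \<Longrightarrow> act g ` E \<subseteq> E"
    and free: "\<And>g h e. g \<in> G \<Longrightarrow> h \<in> G \<Longrightarrow> e \<in> E \<Longrightarrow> act g e = act h e \<Longrightarrow> g = h"
    and orbit: "\<And>e e'. e \<in> E \<Longrightarrow> e' \<in> E \<Longrightarrow> c e = c e' \<longleftrightarrow> (\<exists>g\<in>G. e' = act g e)"
  shows "finite_sheeted_covering E c X"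
proof (rule finite_sheeted_covering_closed_map[OF cont img closed_map])
  have fibre: "{e' \<in> E. c e' = c e} = (\<lambda>g. act g e) ` G" if "e \<in> E" for e
    using orbit[OF that] act(2) that by force
  have inj: "inj_on (\<lambda>g. act g e) G" if "e \<in> E" for e
    using free that by (auto intro: inj_onI)
  fix x assume "x \<in> X"
  then obtain e where e: "e \<in> E" "x = c e" using img by blast
  show "finite {e' \<in> E. c e' = x}" using fibre e fin by simp
  show "card {e' \<in> E. c e' = x} = card G" using fibre e inj by (simp add: card_image)
next
  fix e assume e: "e \<in> E"
  have "uniform_discrete ((\<lambda>g. act g e) ` G)"
    by (intro finite_imp_uniform_discrete finite_imageI fin)
  then obtain d where d: "d > 0"
    "\<And>g h. g \<in> G \<Longrightarrow> h \<in> G \<Longrightarrow> dist (act g e) (act h e) < d \<Longrightarrow> act g e = act h e"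
    unfolding uniform_discrete_def by blast
  obtain g0 where g0: "g0 \<in> G" "e = act g0 e" using orbit[OF e e] by blast
  define U where "U = (E \<inter> ball e (d / 2)) \<inter> (\<Inter>g\<in>G. E \<inter> act g -` ball (act g e) (d / 2))"
  have "openin (top_of_set E) U"
    unfolding U_def using fin g0(1) act(1)
    by (intro openin_Int openin_INT2 openin_open_Int continuous_openin_preimage_gen) auto
  moreover have "e \<in> U" using e d(1) by (simp add: U_def)
  moreover have "inj_on c U"
  proof (rule inj_onI)
    \<comment> \<open>The point \<open>y' = act g y\<close> is close both to \<open>e = act g0 e\<close> and to \<open>act g e\<close>, which are far apart
      unless \<open>g = g0\<close>.\<close>
    have id: "y' = act g0 y" if y: "y \<in> U" "y' \<in> U" "c y = c y'" for y y'
    proof -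
      obtain g where g: "g \<in> G" "y' = act g y"
        using orbit[of y y'] y by (auto simp: U_def)
      have "act g y \<in> ball (act g e) (d / 2)" using y(1) g(1) by (auto simp: U_def split: if_splits)
      moreover have "y' \<in> ball e (d / 2)" using y(2) by (simp add: U_def)
      ultimately have "dist (act g e) y' < d / 2" "dist (act g0 e) y' < d / 2"
        using g(2) g0(2)[symmetric] by simp_all
      then have "dist (act g e) (act g0 e) < d"
        using dist_triangle2[of "act g e" "act g0 e" y'] by linarith
      then have "g = g0" by (rule free[OF g(1) g0(1) e d(2)[OF g(1) g0(1)]])
      then show ?thesis using g by simp
    qed
    fix y y' assume "y \<in> U" "y' \<in> U" "c y = c y'"
    then show "y = y'" using id[of y y'] id[of y y] by metis
  qed
  ultimately show "\<exists>U. openin (top_of_set E) U \<and> e \<in> U \<and> inj_on c U" by blast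
qed

section \<open>The pillow ball as a quotient of the solid torus\<close>

text \<open>
  The quotient map of the solid torus \<open>S\<^sup>1 \<times> D\<^sup>2\<close> by \<open>(u, z) \<mapsto> (cnj u, cnj z)\<close>. On the boundary \<open>|z| = 1\<close> it
  is the pillow map. The simpler extension \<open>(Re u, Re z, Im u * Im z)\<close> would collapse the meridian
  disks \<open>u = \<plusminus>1\<close> to arcs on the pillowcase; the factor \<open>(1 + |z|\<^sup>2) / 2\<close> instead folds each of them along
  its real diameter onto one of the planar disks across which the vertical arcs are pushed in.
\<close>

definition torus_fold :: "complex \<Rightarrow> complex \<Rightarrow> real \<times> real \<times> real"
  where "torus_fold u z = (Re u * (1 + (cmod z)\<^sup>2) / 2, Re z, Im u * Im z)"

lemma torus_fold_cnj [simp]: "torus_fold (cnj u) (cnj z) = torus_fold u z"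
  by (simp add: torus_fold_def)

lemma torus_fold_cis: "torus_fold (cis (pi * x)) (cis (pi * y)) = pillow (x, y)"
  by (simp add: torus_fold_def pillow_def)

lemma unit_complex: "cmod u = 1 \<longleftrightarrow> (Im u)\<^sup>2 = 1 - (Re u)\<^sup>2"
  using cmod_power2[of u] by (auto simp: abs_square_eq_1 power2_eq_1_iff)
 
text \<open>
  Let the first two coordinates \<open>a\<close>, \<open>b\<close> of the image be fixed. The square of the third one is
  \<open>\<tau> (1 - 4 a\<^sup>2 / (1 + b\<^sup>2 + \<tau>)\<^sup>2)\<close> with \<open>\<tau> = (Im z)\<^sup>2\<close>. This increases strictly with \<open>\<tau>\<close> as long as the
  second factor is positive, and that factor is \<open>(Im u)\<^sup>2\<close>. Where it vanishes, a smaller \<open>\<tau>\<close> would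
  need \<open>|Re u| > 1\<close>. So \<open>\<tau>\<close> is determined by the image.
\<close>

lemma torus_fold_height_determined:
  assumes u: "cmod u = 1" "cmod v = 1" and eq: "torus_fold u z = torus_fold v w"
  shows "(Im z)\<^sup>2 \<le> (Im w)\<^sup>2"
proof (rule ccontr)
  assume "\<not> ?thesis"
  then have less: "(Im w)\<^sup>2 < (Im z)\<^sup>2" by simp
  define b \<sigma> \<tau> where "b = 1 + (Re z)\<^sup>2" and "\<sigma> = (Im w)\<^sup>2" and "\<tau> = (Im z)\<^sup>2"
  have re: "Re w = Re z" using eq by (simp add: torus_fold_def)
  have b: "b \<ge> 1" and \<sigma>: "0 \<le> \<sigma>" "\<sigma> < \<tau>" using less by (auto simp: b_def \<sigma>_def \<tau>_def)
  have "1 + (cmod z)\<^sup>2 = b + \<tau>" "1 + (cmod w)\<^sup>2 = b + \<sigma>"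
    unfolding cmod_power2 b_def \<sigma>_def \<tau>_def re by auto
  then have a: "Re u * (b + \<tau>) = Re v * (b + \<sigma>)" and c: "Im u * Im z = Im v * Im w"
    using eq by (auto simp: torus_fold_def)
  have c2: "(Im u)\<^sup>2 * \<tau> = (Im v)\<^sup>2 * \<sigma>"
    using c unfolding \<sigma>_def \<tau>_def by (metis power_mult_distrib)
  have "Im u = 0"
  proof (rule ccontr)
    assume nz: "Im u \<noteq> 0"
    have "\<bar>Re u\<bar> * (b + \<tau>) = \<bar>Re v\<bar> * (b + \<sigma>)" using arg_cong[OF a, of abs] b \<sigma> by (simp add: abs_mult)
    also have "\<dots> \<le> \<bar>Re v\<bar> * (b + \<tau>)" using b \<sigma> by (intro mult_left_mono) auto
    finally have "\<bar>Re u\<bar> \<le> \<bar>Re v\<bar>" using b \<sigma> by simp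
    then have "(Re u)\<^sup>2 \<le> (Re v)\<^sup>2" by (simp add: abs_le_square_iff)
    then have "(Im v)\<^sup>2 \<le> (Im u)\<^sup>2" using u by (simp add: unit_complex)
    then have "(Im v)\<^sup>2 * \<sigma> \<le> (Im u)\<^sup>2 * \<sigma>" using \<sigma> by (intro mult_right_mono)
    also have "\<dots> < (Im u)\<^sup>2 * \<tau>" using nz \<sigma> by (intro mult_strict_left_mono) auto
    finally show False using c2 by simp
  qed
  then have "\<bar>Re u\<bar> = 1" using u by (simp add: unit_complex abs_square_eq_1)
  then have "b + \<tau> = \<bar>Re v\<bar> * (b + \<sigma>)" using arg_cong[OF a, of abs] b \<sigma> by (simp add: abs_mult)
  also have "\<dots> \<le> 1 * (b + \<sigma>)"
    using u b \<sigma> abs_Re_le_cmod[of v] by (intro mult_right_mono) auto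
  finally show False using \<sigma> by simp
qed

lemma torus_fold_eq_iff:
  assumes u: "cmod u = 1" "cmod v = 1"
  shows "torus_fold u z = torus_fold v w \<longleftrightarrow> (v = u \<and> w = z) \<or> (v = cnj u \<and> w = cnj z)"
proof
  assume eq: "torus_fold u z = torus_fold v w"
  have "(Im w)\<^sup>2 = (Im z)\<^sup>2"
    using torus_fold_height_determined[OF u eq] torus_fold_height_determined[OF u(2,1) eq[symmetric]] by simp
  moreover have re: "Re w = Re z" using eq by (simp add: torus_fold_def)
  ultimately have "(cmod w)\<^sup>2 = (cmod z)\<^sup>2" by (simp add: cmod_power2)
  moreover have "1 + (cmod z)\<^sup>2 \<noteq> 0" by (metis add_pos_nonneg zero_less_one zero_le_power2 less_irrefl)
  ultimately have ru: "Re v = Re u" using eq by (simp add: torus_fold_def)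
  then have "(Im v)\<^sup>2 = (Im u)\<^sup>2" using u by (simp add: unit_complex)
  then have "Im v = Im u \<or> Im v = - Im u" "Im w = Im z \<or> Im w = - Im z"
    using \<open>(Im w)\<^sup>2 = (Im z)\<^sup>2\<close> by (auto simp: power2_eq_iff)
  moreover have "Im u * Im z = Im v * Im w" using eq by (simp add: torus_fold_def)
  ultimately show "(v = u \<and> w = z) \<or> (v = cnj u \<and> w = cnj z)"
    using re ru by (auto simp: complex_eq_iff)
qed auto

lemma torus_fold_in_ball:
  assumes "cmod u = 1" "cmod z \<le> 1"
  shows "torus_fold u z \<in> pillow_ball"
    and torus_fold_in_pillowcase_iff: "torus_fold u z \<in> pillowcase \<longleftrightarrow> cmod z = 1"
proof -
  define a b where "a = Re u * (1 + (cmod z)\<^sup>2) / 2" and "b = Re z"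
  have z: "(cmod z)\<^sup>2 \<le> 1" using assms by (simp add: abs_square_le_1)
  have b: "\<bar>b\<bar> \<le> 1" using assms abs_Re_le_cmod[of z] by (simp add: b_def)
  have "\<bar>a\<bar> = \<bar>Re u\<bar> * ((1 + (cmod z)\<^sup>2) / 2)"
    by (simp add: a_def abs_mult)
  also have au: "\<dots> \<le> \<bar>Re u\<bar> * 1" using z by (intro mult_left_mono) auto
  finally have au: "\<bar>a\<bar> \<le> \<bar>Re u\<bar>" by simp
  then have a: "\<bar>a\<bar> \<le> 1" using assms abs_Re_le_cmod[of u] by simp
  have iu: "(Im u)\<^sup>2 \<le> 1 - a\<^sup>2"
    using assms au by (simp add: unit_complex abs_le_square_iff)
  have iz: "(Im z)\<^sup>2 = (cmod z)\<^sup>2 - b\<^sup>2" by (simp add: cmod_power2 b_def)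
  have c: "(Im u * Im z)\<^sup>2 \<le> (1 - a\<^sup>2) * (Im z)\<^sup>2"
    unfolding power_mult_distrib using iu by (intro mult_right_mono) auto
  also have c': "\<dots> \<le> (1 - a\<^sup>2) * (1 - b\<^sup>2)"
    using a z iz by (intro mult_left_mono) (auto simp: abs_square_le_1)
  finally show "torus_fold u z \<in> pillow_ball"
    using a b by (simp add: torus_fold_def pillow_ball_def flip: a_def b_def)
  show "torus_fold u z \<in> pillowcase \<longleftrightarrow> cmod z = 1"
  proof
    assume "cmod z = 1"
    then have "a = Re u" "(Im z)\<^sup>2 = 1 - b\<^sup>2" using iz by (auto simp: a_def)
    then show "torus_fold u z \<in> pillowcase"
      using a b assms(1) unfolding pillowcase_eq
      by (simp add: torus_fold_def power_mult_distrib unit_complex flip: a_def b_def)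
  next
    assume "torus_fold u z \<in> pillowcase"
    then have eq: "(Im u * Im z)\<^sup>2 = (1 - a\<^sup>2) * (1 - b\<^sup>2)"
      by (simp add: pillowcase_eq torus_fold_def flip: a_def b_def)
    have "a\<^sup>2 = 1" if z1: "(cmod z)\<^sup>2 < 1"
    proof -
      have "(1 - a\<^sup>2) * (1 - b\<^sup>2) \<le> (1 - a\<^sup>2) * (Im z)\<^sup>2" using c eq by simp
      then have "(1 - a\<^sup>2) * (1 - (cmod z)\<^sup>2) \<le> 0" by (simp add: iz algebra_simps)
      moreover have "0 \<le> 1 - a\<^sup>2" using a by (simp add: abs_square_le_1)
      ultimately show ?thesis using z1 by (simp add: mult_le_0_iff)
    qed
    moreover have "a\<^sup>2 < 1" if z1: "(cmod z)\<^sup>2 < 1"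
    proof -
      have "\<bar>a\<bar> = \<bar>Re u\<bar> * ((1 + (cmod z)\<^sup>2) / 2)" by (simp add: a_def abs_mult)
      also have "\<dots> \<le> 1 * ((1 + (cmod z)\<^sup>2) / 2)"
        using assms abs_Re_le_cmod[of u] by (intro mult_right_mono) auto
      also have "\<dots> < 1" using z1 by (simp only: mult_1) argo
      finally have "\<bar>a\<bar> < 1" .
      then show ?thesis by (simp add: abs_square_less_1)
    qed
    ultimately have "(cmod z)\<^sup>2 = 1" using z by fastforce
    then show "cmod z = 1" by (simp add: abs_square_eq_1)
  qed
qed

lemma torus_fold_in_vertical_arcs_iff:
  assumes "cmod u = 1" "cmod z \<le> 1"
  shows "torus_fold u z \<in> vertical_arcs \<longleftrightarrow> cnj u = u \<and> cnj z = z"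
proof
  assume fixd: "cnj u = u \<and> cnj z = z"
  then have im: "Im u = 0" "Im z = 0" by (auto simp: complex_eq_iff)
  then have "\<bar>Re u\<bar> = 1" "(cmod z)\<^sup>2 = (Re z)\<^sup>2" 
    using assms by (auto simp: unit_complex abs_square_eq_1 cmod_power2)
  moreover have "\<bar>Re z\<bar> \<le> 1" using assms abs_Re_le_cmod[of z] by simp
  ultimately show "torus_fold u z \<in> vertical_arcs"
    using im unfolding torus_fold_def vertical_arcs_def
    by (intro CollectI exI[of _ "Re u * (1 + (cmod z)\<^sup>2) / 2"] exI[of _ "Re z"])
      (simp add: abs_mult)
next
  assume "torus_fold u z \<in> vertical_arcs"
  then have a: "\<bar>Re u * (1 + (cmod z)\<^sup>2) / 2\<bar> = (1 + (Re z)\<^sup>2) / 2" and c: "Im u * Im z = 0"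
    by (auto simp: torus_fold_def vertical_arcs_def)
  have a': "\<bar>Re u\<bar> * (1 + (Re z)\<^sup>2 + (Im z)\<^sup>2) = 1 + (Re z)\<^sup>2"
    using a by (simp add: abs_mult cmod_power2 add.assoc)
  have "Im u = 0"
  proof (rule ccontr)
    assume nz: "Im u \<noteq> 0"
    then have "\<bar>Re u\<bar> * (1 + (Re z)\<^sup>2) = 1 + (Re z)\<^sup>2" using a' c by simp
    then have "\<bar>Re u\<bar> = 1" using zero_le_power2[of "Re z"] by (simp add: mult_cancel_right1)
    then have "(Re u)\<^sup>2 = 1" by (simp add: abs_square_eq_1)
    then show False using nz assms(1) by (simp add: unit_complex)
  qed
  moreover from this have "\<bar>Re u\<bar> = 1" using assms(1) by (simp add: unit_complex abs_square_eq_1)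
  then have "Im z = 0" using a' by simp
  ultimately show "cnj u = u \<and> cnj z = z" by (simp add: complex_eq_iff)
qed

text \<open>
  The value of \<open>\<tau> = (Im z)\<^sup>2\<close> that realises a given third coordinate comes from the intermediate value
  theorem: the function in \<open>torus_fold_height_determined\<close> vanishes at the least admissible \<open>\<tau>\<close>, and at
  the largest one, \<open>1 - b\<^sup>2\<close>, it takes the value belonging to the pillowcase.
\<close>

lemma torus_fold_surj:
  assumes "x \<in> pillow_ball"
  obtains u z where "cmod u = 1" "cmod z \<le> 1" "torus_fold u z = x"
proof -
  obtain a b c where x: "x = (a, b, c)" by (cases x)
  have ab: "\<bar>a\<bar> \<le> 1" "\<bar>b\<bar> \<le> 1" and c: "c\<^sup>2 \<le> (1 - a\<^sup>2) * (1 - b\<^sup>2)"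
    using assms by (auto simp: x pillow_ball_def)
  have b2: "b\<^sup>2 \<le> 1" using ab by (simp add: abs_square_le_1)
  \<comment> \<open>The least \<open>\<tau> \<ge> 0\<close> for which \<open>|Re u| = 2 |a| / (1 + b\<^sup>2 + \<tau>)\<close> is at most 1.\<close>
  define t0 where "t0 = max 0 (2 * \<bar>a\<bar> - 1 - b\<^sup>2)"
  define C where "C t = 2 * a / (1 + b\<^sup>2 + t)" for t
  define g where "g t = t * (1 - (C t)\<^sup>2)" for t
  have pos: "1 + b\<^sup>2 + t > 0" if "t \<ge> 0" for t using that zero_le_power2[of b] by linarith
  have t0: "0 \<le> t0" "t0 \<le> 1 - b\<^sup>2" using ab b2 by (auto simp: t0_def)
  have "g t0 = 0"
  proof (cases "t0 = 0")
    case False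
    then have "1 + b\<^sup>2 + t0 = 2 * \<bar>a\<bar>" "t0 > 0" by (auto simp: t0_def)
    then have "\<bar>C t0\<bar> = 1" using pos[of t0] by (simp add: C_def abs_mult)
    then have "(C t0)\<^sup>2 = 1" by (simp add: abs_square_eq_1)
    then show ?thesis by (simp add: g_def)
  qed (simp add: g_def)
  then have "g t0 \<le> c\<^sup>2" by simp
  moreover have "c\<^sup>2 \<le> g (1 - b\<^sup>2)" using c by (simp add: g_def C_def mult.commute)
  moreover have "continuous_on {t0..1 - b\<^sup>2} g"
    unfolding g_def C_def using pos t0 by (intro continuous_intros) (auto, fastforce)
  ultimately obtain t where t: "t0 \<le> t" "t \<le> 1 - b\<^sup>2" "g t = c\<^sup>2"
    using IVT'[of g t0 "c\<^sup>2" "1 - b\<^sup>2"] t0 by auto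
  have tp: "t \<ge> 0" "1 + b\<^sup>2 + t > 0" using t t0 pos[of t] by auto
  have "2 * \<bar>a\<bar> \<le> 1 + b\<^sup>2 + t" using t by (simp add: t0_def)
  then have "\<bar>C t\<bar> \<le> 1" using tp by (simp add: C_def abs_mult)
  then have C2: "(C t)\<^sup>2 \<le> 1" by (simp add: abs_square_le_1)
  \<comment> \<open>Only \<open>Im u\<close> carries a sign; conjugating both \<open>u\<close> and \<open>z\<close> would move it to \<open>Im z\<close>.\<close>
  define e where "e = (if c < 0 then - 1 else 1 :: real)"
  define u where "u = Complex (C t) (e * sqrt (1 - (C t)\<^sup>2))"
  define z where "z = Complex b (sqrt t)"
  have "e * e = 1" by (simp add: e_def)
  then have "cmod u = 1"
    using C2 by (simp add: unit_complex u_def power_mult_distrib power2_eq_square[of e])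
  moreover have z2: "(cmod z)\<^sup>2 = b\<^sup>2 + t" using tp by (simp add: cmod_power2 z_def)
  then have "cmod z \<le> 1" using t(2) abs_square_le_1[of "cmod z"] by simp
  moreover have "torus_fold u z = x"
  proof -
    have "sqrt (1 - (C t)\<^sup>2) * sqrt t = \<bar>c\<bar>"
      using t(3) by (simp add: g_def mult.commute flip: real_sqrt_mult)
    then have "Im u * Im z = c" by (simp add: u_def z_def e_def)
    moreover have "Re u * (1 + (cmod z)\<^sup>2) / 2 = a"
      using tp by (simp add: u_def z2 C_def add.assoc)
    ultimately show ?thesis by (simp add: x torus_fold_def z_def)
  qed
  ultimately show thesis by (rule that)
qed

section \<open>The cyclic group of the lens space\<close>

text \<open>
  For coprime \<open>m \<noteq> 0\<close> and \<open>n\<close>, the deck group of the universal covering of a lens space. A pair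
  \<open>(\<alpha>, \<beta>)\<close> acts on \<open>\<complex>\<^sup>2\<close> by \<open>(z, w) \<mapsto> (\<alpha> z, \<beta> w)\<close>. The exponent \<open>- n\<close> makes \<open>z\<^sup>n w\<close> invariant.
\<close>

definition lens_group :: "int \<Rightarrow> int \<Rightarrow> (complex \<times> complex) set"
  where "lens_group m n = {(\<alpha>, \<alpha> powi (- n)) | \<alpha>. cmod \<alpha> = 1 \<and> \<alpha> powi m = 1}"

lemma lens_group_norm:
  assumes "(\<alpha>, \<beta>) \<in> lens_group m n"
  shows "cmod \<alpha> = 1" "cmod \<beta> = 1"
  using assms by (auto simp: lens_group_def norm_power_int)

lemma finite_lens_group:
  assumes "m \<noteq> 0"
  shows "finite (lens_group m n)"
proof -
  have "\<alpha> ^ nat \<bar>m\<bar> = 1" if "\<alpha> powi m = 1" for \<alpha> :: complex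
    using that by (cases "m \<ge> 0") (auto simp: power_int_def power_inverse)
  then have "{\<alpha>::complex. \<alpha> powi m = 1} \<subseteq> {\<alpha>. \<alpha> ^ nat \<bar>m\<bar> = 1}"
    by auto
  moreover have "finite {\<alpha>::complex. \<alpha> ^ nat \<bar>m\<bar> = 1}"
    using assms by (intro finite_roots_unity) auto
  ultimately have "finite {\<alpha>::complex. \<alpha> powi m = 1}"
    by (rule finite_subset)
  then have "finite ((\<lambda>\<alpha>. (\<alpha>, \<alpha> powi (- n))) ` {\<alpha>::complex. \<alpha> powi m = 1})"
    by (rule finite_imageI)
  then show ?thesis
    by (rule rev_finite_subset) (auto simp: lens_group_def)
qed

lemma lens_group_swap_subset:
  assumes "\<bar>q\<bar> = \<bar>m\<bar>" "m dvd p * n - 1" "(\<alpha>, \<beta>) \<in> lens_group m n"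
  shows "(\<beta>, \<alpha>) \<in> lens_group q p"
proof -
  have \<alpha>: "cmod \<alpha> = 1" "\<alpha> powi m = 1" "\<beta> = \<alpha> powi (- n)"
    using assms(3) by (auto simp: lens_group_def)
  then have nz: "\<alpha> \<noteq> 0" by auto
  have mult: "\<alpha> powi (m * k) = 1" for k
    using \<alpha>(2) by (simp add: power_int_mult)
  have "m dvd - n * q" using assms(1) by (metis dvd_abs_iff dvd_triv_right dvd_mult abs_dvd_iff dvd_refl)
  then obtain k where "- n * q = m * k" by blast
  then have "\<beta> powi q = 1"
    using mult[of k] by (simp only: \<alpha>(3) flip: power_int_mult)
  moreover obtain l where l: "p * n - 1 = m * l" using assms(2) by blast
  have "\<beta> powi (- p) = \<alpha> powi (1 + m * l)"
  proof -
    have "- n * - p = 1 + m * l" using l by (simp add: mult.commute)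
    then show ?thesis by (simp only: \<alpha>(3) flip: power_int_mult)
  qed
  then have "\<beta> powi (- p) = \<alpha>"
    using nz mult[of l] by (simp add: power_int_add)
  moreover have "cmod \<beta> = 1" using \<alpha> by (simp add: norm_power_int)
  ultimately show ?thesis
    unfolding lens_group_def by (auto intro!: exI[of _ \<beta>])
qed

text \<open>
  The same group can be parametrised by its second component. This is where the two solid tori of
  the three-sphere are found to be divided by the same rotations.
\<close>

lemma lens_group_swap:
  assumes "\<bar>q\<bar> = \<bar>m\<bar>" "m dvd p * n - 1"
  shows "(\<alpha>, \<beta>) \<in> lens_group m n \<longleftrightarrow> (\<beta>, \<alpha>) \<in> lens_group q p"
proof -
  have "q dvd n * p - 1" using assms by (metis abs_dvd_iff mult.commute)
  then show ?thesis
    using lens_group_swap_subset assms by metis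
qed

lemma lens_group_eq_iff:
  assumes swap: "\<bar>q\<bar> = \<bar>m\<bar>" "m dvd p * n - 1"
    and mem: "(\<alpha>, \<beta>) \<in> lens_group m n" "(\<alpha>', \<beta>') \<in> lens_group m n"
  shows "\<alpha> = \<alpha>' \<longleftrightarrow> \<beta> = \<beta>'"
proof
  assume "\<alpha> = \<alpha>'"
  then show "\<beta> = \<beta>'" using mem by (auto simp: lens_group_def)
next
  assume "\<beta> = \<beta>'"
  moreover have "(\<beta>, \<alpha>) \<in> lens_group q p" "(\<beta>', \<alpha>') \<in> lens_group q p"
    using mem lens_group_swap[OF swap] by blast+
  ultimately show "\<alpha> = \<alpha>'" by (auto simp: lens_group_def)
qed

lemma lens_group_divide:
  assumes "(\<alpha>, \<beta>) \<in> lens_group m n" "(\<alpha>', \<beta>') \<in> lens_group m n"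
  shows "(\<alpha> / \<alpha>', \<beta> / \<beta>') \<in> lens_group m n"
  using assms by (auto simp: lens_group_def norm_divide power_int_divide_distrib)

section \<open>Branched coverings of the pillow ball by solid tori\<close>

text \<open>
  The solid torus \<open>|w| \<le> |z|\<close> in the three-sphere has the coordinates \<open>z / |z|\<close> on the circle and
  \<open>w / |z|\<close> on the disk. The map divides it first by \<open>lens_group m n\<close> and then by conjugation.
\<close>

definition lens_fold :: "int \<Rightarrow> int \<Rightarrow> complex \<Rightarrow> complex \<Rightarrow> real \<times> real \<times> real"
  where "lens_fold m n z w = torus_fold (sgn z powi m) (sgn z powi n * (w / cmod z))"

text \<open>
  The covering \<open>(u, v) \<mapsto> (u\<^sup>m, u\<^sup>n v)\<close> of solid tori has the orbits of \<open>lens_group m n\<close> as its fibres: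
  the quotient \<open>\<alpha>\<close> of two circle coordinates with the same image is a root of unity, and the
  equality of the norms makes the radii agree.
\<close>

lemma solid_torus_covering_fibre:
  assumes nz: "z \<noteq> 0" "z' \<noteq> 0"
    and norm: "(cmod z)\<^sup>2 + (cmod w)\<^sup>2 = (cmod z')\<^sup>2 + (cmod w')\<^sup>2"
  shows "sgn z' powi m = sgn z powi m \<and> sgn z' powi n * (w' / cmod z') = sgn z powi n * (w / cmod z)
    \<longleftrightarrow> (\<exists>(\<alpha>, \<beta>)\<in>lens_group m n. z' = \<alpha> * z \<and> w' = \<beta> * w)" (is "?L \<longleftrightarrow> ?R")
proof
  assume L: ?L
  define \<alpha> where "\<alpha> = sgn z' / sgn z"
  have s: "sgn z \<noteq> 0" "sgn z' \<noteq> 0" "cmod (sgn z) = 1" "cmod (sgn z') = 1"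
    using nz by (auto simp: norm_sgn sgn_zero_iff)
  have \<alpha>: "cmod \<alpha> = 1" "\<alpha> powi m = 1"
    using L s by (simp_all add: \<alpha>_def norm_divide power_int_divide_distrib)
  have "cmod w' / cmod z' = cmod w / cmod z"
    using arg_cong[OF conjunct2[OF L], of cmod] s by (simp add: norm_mult norm_divide norm_power_int)
  then have "1 + (cmod w' / cmod z')\<^sup>2 = 1 + (cmod w / cmod z)\<^sup>2" by simp
  then have "((cmod z')\<^sup>2 + (cmod w')\<^sup>2) / (cmod z')\<^sup>2 = ((cmod z)\<^sup>2 + (cmod w)\<^sup>2) / (cmod z)\<^sup>2"
    using nz by (simp add: power_divide add_divide_distrib)
  moreover have "(cmod z)\<^sup>2 + (cmod w)\<^sup>2 \<noteq> 0" using nz by simp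
  ultimately have "(cmod z')\<^sup>2 = (cmod z)\<^sup>2"
    unfolding norm[symmetric] by (metis divide_cancel_left)
  then have nzz: "cmod z' = cmod z" by simp
  have pol: "z = cmod z * sgn z" "z' = cmod z' * sgn z'"
    using nz by (simp_all add: sgn_eq)
  have "z' = \<alpha> * z"
    using pol nzz s by (metis \<alpha>_def nonzero_eq_divide_eq mult.commute mult.left_commute)
  moreover have "w' = \<alpha> powi (- n) * w"
  proof -
    have "sgn z' powi n * w' = sgn z powi n * w"
      using L nzz nz by simp
    then have "w' = sgn z powi n / sgn z' powi n * w"
      using s by (simp add: field_simps)
    then show ?thesis by (simp add: \<alpha>_def power_int_minus power_int_divide_distrib)
  qed
  ultimately show ?R using \<alpha> by (auto simp: lens_group_def)
next
  assume ?R
  then obtain \<alpha> where \<alpha>: "cmod \<alpha> = 1" "\<alpha> powi m = 1" "z' = \<alpha> * z" "w' = \<alpha> powi (- n) * w"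
    by (auto simp: lens_group_def)
  have "\<alpha> \<noteq> 0" using \<alpha>(1) by auto
  moreover have "sgn z' = \<alpha> * sgn z" using \<alpha> by (simp add: sgn_eq norm_mult)
  moreover have "cmod z' = cmod z" using \<alpha> by (simp add: norm_mult)
  ultimately show ?L
    using \<alpha> by (simp add: power_int_mult_distrib power_int_minus)
qed

lemma lens_fold_eq_iff:
  assumes nz: "z \<noteq> 0" "z' \<noteq> 0"
    and norm: "(cmod z)\<^sup>2 + (cmod w)\<^sup>2 = (cmod z')\<^sup>2 + (cmod w')\<^sup>2"
  shows "lens_fold m n z w = lens_fold m n z' w' \<longleftrightarrow>
    (\<exists>(\<alpha>, \<beta>)\<in>lens_group m n. z' = \<alpha> * z \<and> w' = \<beta> * w \<or> z' = \<alpha> * cnj z \<and> w' = \<beta> * cnj w)"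
proof -
  have u: "cmod (sgn z powi m) = 1" "cmod (sgn z' powi m) = 1"
    using nz by (simp_all add: norm_power_int norm_sgn)
  have cs: "cnj (sgn z) = sgn (cnj z)" by (simp add: sgn_eq)
  have "lens_fold m n z w = lens_fold m n z' w' \<longleftrightarrow>
    (sgn z' powi m = sgn z powi m \<and> sgn z' powi n * (w' / cmod z') = sgn z powi n * (w / cmod z)) \<or>
    (sgn z' powi m = sgn (cnj z) powi m \<and>
      sgn z' powi n * (w' / cmod z') = sgn (cnj z) powi n * (cnj w / cmod (cnj z)))"
    unfolding lens_fold_def torus_fold_eq_iff[OF u] by (simp add: cs)
  then show ?thesis
    using solid_torus_covering_fibre[OF nz norm, of m n]
      solid_torus_covering_fibre[of "cnj z" z' "cnj w" w' m n] nz norm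
    by (auto simp: case_prod_unfold)
qed

text \<open>
  The vertical arcs are the images of the points of the quotient solid torus that are fixed by
  conjugation. Since the points over such a point form one orbit, this says that a rotation takes the
  conjugate of \<open>(z, w)\<close> back to \<open>(z, w)\<close>.
\<close>

lemma lens_fold_in_vertical_arcs_iff:
  assumes "z \<noteq> 0" "cmod w \<le> cmod z"
  shows "lens_fold m n z w \<in> vertical_arcs \<longleftrightarrow>
    (\<exists>(\<alpha>, \<beta>)\<in>lens_group m n. z = \<alpha> * cnj z \<and> w = \<beta> * cnj w)"
proof -
  have u: "cmod (sgn z powi m) = 1" "cmod (sgn z powi n * (w / cmod z)) \<le> 1"
    using assms by (simp_all add: norm_power_int norm_sgn norm_mult norm_divide)
  have cs: "cnj (sgn z) = sgn (cnj z)" by (simp add: sgn_eq)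
  have "lens_fold m n z w \<in> vertical_arcs \<longleftrightarrow> sgn z powi m = sgn (cnj z) powi m \<and>
      sgn z powi n * (w / cmod z) = sgn (cnj z) powi n * (cnj w / cmod (cnj z))"
    unfolding lens_fold_def torus_fold_in_vertical_arcs_iff[OF u] by (auto simp: cs)
  then show ?thesis
    using solid_torus_covering_fibre[of "cnj z" z "cnj w" w m n] assms by simp
qed

lemma lens_fold_in_ball:
  assumes "z \<noteq> 0" "cmod w \<le> cmod z"
  shows "lens_fold m n z w \<in> pillow_ball"
    and lens_fold_in_pillowcase_iff: "lens_fold m n z w \<in> pillowcase \<longleftrightarrow> cmod w = cmod z"
proof -
  have u: "cmod (sgn z powi m) = 1" "cmod (sgn z powi n * (w / cmod z)) \<le> 1"
    using assms by (simp_all add: norm_power_int norm_sgn norm_mult norm_divide)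
  then show "lens_fold m n z w \<in> pillow_ball"
    unfolding lens_fold_def by (rule torus_fold_in_ball)
  show "lens_fold m n z w \<in> pillowcase \<longleftrightarrow> cmod w = cmod z"
    unfolding lens_fold_def torus_fold_in_pillowcase_iff[OF u]
    using assms by (auto simp: norm_power_int norm_sgn norm_mult norm_divide)
qed

lemma lens_fold_surj:
  assumes "m \<noteq> 0" "x \<in> pillow_ball"
  obtains z w where "z \<noteq> 0" "cmod w \<le> cmod z" "(cmod z)\<^sup>2 + (cmod w)\<^sup>2 = 1" "lens_fold m n z w = x"
proof -
  obtain U Z where UZ: "cmod U = 1" "cmod Z \<le> 1" "torus_fold U Z = x"
    using torus_fold_surj[OF assms(2)] .
  define u where "u = cis (Arg U / of_int m)"
  have "U \<noteq> 0" using UZ(1) by auto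
  then have "u powi m = U"
    using assms(1) UZ(1) by (simp add: u_def cis_power_int cis_Arg sgn_eq)
  have u: "cmod u = 1" "u \<noteq> 0" by (simp_all add: u_def)
  define r where "r = 1 / sqrt (1 + (cmod Z)\<^sup>2)"
  have pos: "1 + (cmod Z)\<^sup>2 > 0" by (simp add: add_pos_nonneg)
  then have r: "r > 0" by (simp add: r_def)
  have r2: "r\<^sup>2 * (1 + (cmod Z)\<^sup>2) = 1"
    using pos by (simp add: r_def power_divide)
  define z w where "z = r * u" and "w = r * (u powi (- n) * Z)"
  have nz: "z \<noteq> 0" using r u by (simp add: z_def)
  have cz: "cmod z = r" "cmod w = r * cmod Z"
    using r u by (simp_all add: z_def w_def norm_mult norm_power_int)
  have "sgn z = u" using r u by (simp add: sgn_eq cz) (simp add: z_def)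
  then have "lens_fold m n z w = x"
    using r u \<open>u powi m = U\<close> UZ(3) by (simp add: lens_fold_def cz) (simp add: w_def power_int_minus flip: mult.assoc)
  moreover have "cmod w \<le> cmod z" using r UZ(2) by (simp add: cz)
  moreover have "(cmod z)\<^sup>2 + (cmod w)\<^sup>2 = 1"
    using r2 by (simp add: cz power_mult_distrib algebra_simps)
  ultimately show thesis using that nz by blast
qed

text \<open>
  On the torus \<open>|z| = |w|\<close>, in angular coordinates, the fold is an integer linear map followed by
  \<open>pillow\<close>, just like the gluing map of the two balls.
\<close>

lemma lens_fold_torus:
  assumes "z \<noteq> 0" "cmod w = cmod z" and sz: "sgn z = cis (pi * \<theta>)" and sw: "sgn w = cis (pi * \<phi>)"
  shows "lens_fold m n z w = pillow (of_int m * \<theta>, of_int n * \<theta> + \<phi>)"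
proof -
  have "w / cmod z = cis (pi * \<phi>)" using sw assms(2) by (simp add: sgn_eq)
  then have "lens_fold m n z w = torus_fold (cis (pi * (of_int m * \<theta>))) (cis (pi * (of_int n * \<theta> + \<phi>)))"
    unfolding lens_fold_def sz by (simp add: cis_power_int cis_mult algebra_simps)
  then show ?thesis by (simp only: torus_fold_cis)
qed

lemma continuous_on_lens_fold [continuous_intros]:
  assumes "continuous_on S f" "continuous_on S g" "\<And>x. x \<in> S \<Longrightarrow> f x \<noteq> 0"
  shows "continuous_on S (\<lambda>x. lens_fold m n (f x) (g x))"
  unfolding lens_fold_def torus_fold_def
  using assms by (intro continuous_intros) (auto simp: sgn_zero_iff)

section \<open>The gluing map in pillowcase coordinates\<close>

lemma pillow_minus: "pillow (- v) = pillow v"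
  by (cases v) (simp add: pillow_def)

lemma pillow_eq_origin_iff: "pillow (2 *\<^sub>R v) = pillow 0 \<longleftrightarrow> v \<in> \<int> \<times> \<int>"
  unfolding pillow_eq_iff by (cases v) (auto simp: Ints_def zero_prod_def)

lemma int_multiples_imp_zero:
  fixes x :: real
  assumes "\<And>t. t * x \<in> \<int>"
  shows "x = 0"
proof (rule ccontr)
  assume "x \<noteq> 0"
  then have "1 / 2 \<in> (\<int> :: real set)" using assms[of "1 / (2 * x)"] by simp
  then show False by (simp add: fraction_not_in_Ints[of 2 1, simplified])
qed

text \<open>
  The integer points are the halves of the points that \<open>pillow\<close> identifies with the origin. As \<open>h\<close>
  is injective, the linear lift therefore preserves integrality in both directions. Its kernel
  then consists of integer points, and a subspace of integer points is trivial.
\<close>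

lemma two_bridge_gluing_linear:
  assumes glue: "two_bridge_gluing p q h"
  obtains A where "linear A" "bij A" "\<And>v. h (pillow v) = pillow (A v)"
    "\<And>v. A v \<in> \<int> \<times> \<int> \<longleftrightarrow> v \<in> \<int> \<times> \<int>"
proof -
  from glue obtain g where hom: "homeomorphism pillowcase pillowcase h g"
    by (auto simp: two_bridge_gluing_def)
  from glue obtain A where A: "linear A" and hA: "\<And>v. h (pillow v) = pillow (A v)"
    by (auto simp: two_bridge_gluing_def)
  have inj: "h (pillow v) = h (pillow w) \<longleftrightarrow> pillow v = pillow w" for v w
    using homeomorphism_apply1[OF hom] by (metis pillowcase_def rangeI)
  have int: "A v \<in> \<int> \<times> \<int> \<longleftrightarrow> v \<in> \<int> \<times> \<int>" for v
  proof -
    have "A v \<in> \<int> \<times> \<int> \<longleftrightarrow> pillow (A (2 *\<^sub>R v)) = pillow (A 0)"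
      by (simp only: pillow_eq_origin_iff linear_scale[OF A] linear_0[OF A])
    then show ?thesis
      by (simp only: inj pillow_eq_origin_iff flip: hA)
  qed
  have "inj A"
  proof (subst linear_injective_0[OF A], intro allI impI)
    fix v assume v: "A v = 0"
    have "t *\<^sub>R v \<in> \<int> \<times> \<int>" for t
      using int[of "t *\<^sub>R v"] v by (simp add: linear_scale[OF A] zero_prod_def)
    then have "t * fst v \<in> \<int>" "t * snd v \<in> \<int>" for t
      by (metis fst_scaleR snd_scaleR real_scaleR_def mem_Times_iff)+
    then show "v = 0"
      using int_multiples_imp_zero by (simp add: prod_eq_iff)
  qed
  moreover from this have "surj A"
    using A linear_injective_imp_surjective by blast
  ultimately have "bij A" by (simp add: bij_def)
  then show thesis using that A hA int by blast
qed

text \<open>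
  For all \<open>t\<close> the point \<open>t A(0, 1)\<close> lies on a line of slope \<open>p/q\<close> through an integer point. Hence the
  determinant of \<open>t A(0, 1)\<close> and \<open>(q, p)\<close> is an integer for every \<open>t\<close>, which forces it to vanish.
\<close>

lemma two_bridge_gluing_slope:
  assumes glue: "two_bridge_gluing p q h" and A: "linear A" "\<And>v. h (pillow v) = pillow (A v)"
  shows "fst (A (0, 1)) * of_int p = snd (A (0, 1)) * of_int q"
proof -
  obtain x y where xy: "A (0, 1) = (x, y)" by (cases "A (0, 1)")
  have "t * (x * of_int p - y * of_int q) \<in> \<int>" for t
  proof -
    have "pillow (of_int 0 + t * of_int 0, of_int 0 + t * of_int 1) \<in> slope_arcs 1 0"
      unfolding slope_arcs_def by blast
    then have "pillow (t *\<^sub>R (0, 1)) \<in> slope_arcs 1 0" by simp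
    then have "h (pillow (t *\<^sub>R (0, 1))) \<in> slope_arcs p q"
      using glue unfolding two_bridge_gluing_def by auto
    then have "pillow (t * x, t * y) \<in> slope_arcs p q"
      by (simp only: A(2) linear_scale[OF A(1)] xy) simp
    then obtain i j s where
      "pillow (t * x, t * y) = pillow (of_int i + s * of_int q, of_int j + s * of_int p)"
      unfolding slope_arcs_def by blast
    then consider a b where "t * x = of_int i + s * of_int q + 2 * of_int a"
        "t * y = of_int j + s * of_int p + 2 * of_int b"
      | a b where "t * x = 2 * of_int a - (of_int i + s * of_int q)"
        "t * y = 2 * of_int b - (of_int j + s * of_int p)"
      unfolding pillow_eq_iff by auto
    then have "t * x * of_int p - t * y * of_int q \<in> \<int>"
    proof cases
      case 1
      have "t * x * of_int p - t * y * of_int q = of_int ((i + 2 * a) * p - (j + 2 * b) * q)"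
        unfolding 1 by (simp add: algebra_simps)
      then show ?thesis by (metis Ints_of_int)
    next
      case 2
      have "t * x * of_int p - t * y * of_int q = of_int ((2 * a - i) * p - (2 * b - j) * q)"
        unfolding 2 by (simp add: algebra_simps)
      then show ?thesis by (metis Ints_of_int)
    qed
    then show ?thesis by (simp add: algebra_simps)
  qed
  then have "x * of_int p - y * of_int q = 0" by (rule int_multiples_imp_zero)
  then show ?thesis by (simp add: xy)
qed

text \<open>
  By \<open>two_bridge_gluing_slope\<close> and the coprimality, \<open>A (0, 1) = k (q, p)\<close> with \<open>k = \<plusminus>1\<close>. Let \<open>(m, n)\<close> be the
  integer point with \<open>A (m, n) = (0, k)\<close>. Then \<open>A (\<theta> (m, n) + \<phi> (0, 1)) = k (\<phi> (q, p) + \<theta> (0, 1))\<close>, and \<open>pillow\<close>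
  does not see the sign \<open>k\<close>. The arithmetic of \<open>m\<close> and \<open>n\<close> follows because \<open>A\<close> is invertible over the
  integers.
\<close>

lemma two_bridge_gluing_lens:
  assumes glue: "two_bridge_gluing p q h" and cop: "coprime p q" and q: "q \<noteq> 0"
  obtains m n where "\<bar>q\<bar> = \<bar>m\<bar>" "m dvd p * n - 1"
    "\<And>\<theta> \<phi>. h (pillow (of_int m * \<theta>, of_int n * \<theta> + \<phi>)) = pillow (of_int q * \<phi>, of_int p * \<phi> + \<theta>)"
proof -
  obtain A where A: "linear A" "bij A" "\<And>v. h (pillow v) = pillow (A v)"
    and int: "\<And>v. A v \<in> \<int> \<times> \<int> \<longleftrightarrow> v \<in> \<int> \<times> \<int>"
    using two_bridge_gluing_linear[OF glue] by blast
  have inj: "A v = A w \<longleftrightarrow> v = w" for v w using A(2) by (auto simp: bij_def inj_eq)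
  have pre: "\<exists>i j. A (of_int i, of_int j) = (of_int a, of_int b)" for a b
  proof -
    obtain v where v: "A v = (of_int a, of_int b)" using A(2) by (metis bij_pointE)
    then have "v \<in> \<int> \<times> \<int>" using int[of v] by auto
    then show ?thesis using v by (auto elim!: Ints_cases)
  qed
  have img: "\<exists>a b. A (of_int i, of_int j) = (of_int a, of_int b)" for i j
    using int[of "(of_int i, of_int j)"] by (cases "A (of_int i, of_int j)") (auto elim!: Ints_cases)
  obtain x y :: int where xy: "A (0, 1) = (of_int x, of_int y)" using img[of 0 1] by auto
  have "real_of_int (x * p) = of_int (y * q)"
    using two_bridge_gluing_slope[OF glue A(1,3)] by (simp add: xy)
  then have xpyq: "x * p = y * q" by (simp only: of_int_eq_iff)
  then have "q dvd x" using cop by (metis coprime_commute coprime_dvd_mult_left_iff dvd_triv_right)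
  then obtain k where k: "x = k * q" by (metis dvdE mult.commute)
  then have yk: "y = k * p" using xpyq q by simp
  have A01: "A (0, 1) = of_int k *\<^sub>R (of_int q, of_int p)" by (simp add: xy k yk)
  have Alin: "A (a, b) = a *\<^sub>R A (1, 0) + b *\<^sub>R A (0, 1)" for a b
    by (simp flip: linear_scale[OF A(1)] linear_add[OF A(1)])
  \<comment> \<open>The column \<open>(x, y)\<close> is primitive, as \<open>A\<close> is invertible over the integers; so \<open>k\<close> is a unit.\<close>
  obtain a b where "A (of_int a, of_int b) = (of_int q, of_int p)" using pre by blast
  then have "A (of_int k *\<^sub>R (of_int a, of_int b)) = A (0, 1)"
    by (simp only: linear_scale[OF A(1)] A01)
  then have "real_of_int (k * b) = of_int 1" unfolding inj by simp
  then have "k * b = 1" by (simp only: of_int_eq_iff)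
  then have k1: "k = 1 \<or> k = - 1" by (metis zmult_eq_1_iff)
  obtain r s :: int where rs: "A (1, 0) = (of_int r, of_int s)" using img[of 1 0] by auto
  obtain m n where mn: "A (of_int m, of_int n) = (of_int 0, of_int k)" using pre by blast
  obtain r' s' where rs': "A (of_int r', of_int s') = (of_int 1, of_int 0)" using pre by blast
  have "real_of_int (m * r + n * (k * q)) = of_int 0 \<and> real_of_int (m * s + n * (k * p)) = of_int k"
    using mn by (simp add: Alin[of "of_int m"] rs A01)
  then have m: "m * r + n * (k * q) = 0" "m * s + n * (k * p) = k"
    by (simp_all only: of_int_eq_iff)
  have "real_of_int (r' * r + s' * (k * q)) = of_int 1"
    using rs' by (simp add: Alin[of "of_int r'"] rs A01)
  then have r: "r' * r + s' * (k * q) = 1" by (simp only: of_int_eq_iff)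
  have "p * n - 1 = m * (- s * k)" using m(2) k1 by (auto simp: algebra_simps)
  then have dvd: "m dvd p * n - 1" by simp
  have "coprime m n"
  proof (rule coprimeI)
    fix d assume d: "d dvd m" "d dvd n"
    then have "d dvd p * n" "d dvd p * n - 1" using dvd by (auto intro: dvd_trans)
    then have "d dvd p * n - (p * n - 1)" by (rule dvd_diff)
    then show "is_unit d" by simp
  qed
  moreover have "n * q = m * (- r * k)" using m(1) k1 by (auto simp: algebra_simps)
  ultimately have "m dvd q" by (metis coprime_dvd_mult_right_iff dvd_triv_left)
  moreover have "coprime q r"
  proof (rule coprimeI)
    fix d assume "d dvd q" "d dvd r"
    then have "d dvd r' * r + s' * (k * q)" by simp
    then show "is_unit d" using r by simp
  qed
  moreover have "q dvd m * r" using m(1) by (metis dvd_add_left_iff dvd_0_right dvd_mult dvd_refl)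
  ultimately have mq: "\<bar>q\<bar> = \<bar>m\<bar>"
    by (intro zdvd_antisym_abs) (metis coprime_dvd_mult_left_iff)+
  have "h (pillow (of_int m * \<theta>, of_int n * \<theta> + \<phi>)) = pillow (of_int q * \<phi>, of_int p * \<phi> + \<theta>)" for \<theta> \<phi>
  proof -
    have "(of_int m * \<theta>, of_int n * \<theta> + \<phi>) = \<theta> *\<^sub>R (of_int m, of_int n) + \<phi> *\<^sub>R (0, 1)" by simp
    then have "A (of_int m * \<theta>, of_int n * \<theta> + \<phi>) = \<theta> *\<^sub>R (0, of_int k) + \<phi> *\<^sub>R of_int k *\<^sub>R (of_int q, of_int p)"
      using mn by (simp only: linear_add[OF A(1)] linear_scale[OF A(1)] A01 of_int_0)
    also have "\<dots> = of_int k *\<^sub>R (of_int q * \<phi>, of_int p * \<phi> + \<theta>)"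
      by (simp add: algebra_simps)
    finally have "h (pillow (of_int m * \<theta>, of_int n * \<theta> + \<phi>)) =
        pillow (of_int k *\<^sub>R (of_int q * \<phi>, of_int p * \<phi> + \<theta>))"
      by (simp only: A(3))
    moreover have "pillow (of_int k *\<^sub>R v) = pillow v" for v
      using k1 pillow_minus[of v] by auto
    ultimately show ?thesis by (simp only:)
  qed
  then show thesis using that mq dvd by blast
qed

section \<open>Conjugate-linear symmetries of the three-sphere and their great circles\<close>

definition zcoord :: "real^4 \<Rightarrow> complex"
  where "zcoord x = Complex (x $ 1) (x $ 2)"

definition wcoord :: "real^4 \<Rightarrow> complex"
  where "wcoord x = Complex (x $ 3) (x $ 4)"

definition of_coords :: "complex \<Rightarrow> complex \<Rightarrow> real^4"
  where "of_coords z w = vector [Re z, Im z, Re w, Im w]"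

lemma coords_of_coords [simp]: "zcoord (of_coords z w) = z" "wcoord (of_coords z w) = w"
  by (simp_all add: zcoord_def wcoord_def of_coords_def vector_4_sel)

lemma eq_of_coords_iff: "x = of_coords z w \<longleftrightarrow> zcoord x = z \<and> wcoord x = w"
  by (auto simp: zcoord_def wcoord_def of_coords_def vec_eq_iff forall_4 vector_4_sel complex_eq_iff)

lemma sphere_coords: "x \<in> sphere 0 1 \<longleftrightarrow> (cmod (zcoord x))\<^sup>2 + (cmod (wcoord x))\<^sup>2 = 1"
  unfolding sphere4_iff by (simp add: zcoord_def wcoord_def cmod_power2 add.assoc)

lemma sphere_coords_nonzero: "x \<in> sphere 0 1 \<Longrightarrow> zcoord x \<noteq> 0 \<or> wcoord x \<noteq> 0"
  unfolding sphere_coords by auto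

lemma linear_coords: "linear zcoord" "linear wcoord"
  by (auto intro!: linearI simp: zcoord_def wcoord_def complex_eq_iff)

lemma continuous_on_coords [continuous_intros]:
  "continuous_on S zcoord" "continuous_on S wcoord"
  using linear_coords by (auto intro: linear_continuous_on simp: linear_linear)

lemma continuous_on_of_coords [continuous_intros]:
  assumes "continuous_on S f" "continuous_on S g"
  shows "continuous_on S (\<lambda>x. of_coords (f x) (g x))"
proof -
  have "continuous_on S (\<lambda>x. of_coords (f x) (g x) $ i)" for i
  proof -
    consider "i = 1" | "i = 2" | "i = 3" | "i = 4" using exhaust_4[of i] by blast
    then show ?thesis
      by cases (simp_all only: of_coords_def vector_4_sel, (intro continuous_intros assms)+)
  qed
  then have "continuous_on S (\<lambda>x. \<chi> i. of_coords (f x) (g x) $ i)"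
    by (rule continuous_on_vec_lambda)
  then show ?thesis by simp
qed

text \<open>
  With a square root \<open>a\<close> of \<open>\<alpha>\<close>, the equation \<open>z = \<alpha> cnj z\<close> says that \<open>z / a\<close> is real.
\<close>

lemma conjugate_multiple_line:
  assumes "cmod \<alpha> = 1"
  obtains a where "a \<noteq> 0" "\<And>z. z = \<alpha> * cnj z \<longleftrightarrow> (\<exists>s. z = complex_of_real s * a)"
proof
  define a where "a = csqrt \<alpha>"
  have a2: "a * a = \<alpha>" by (simp add: a_def flip: power2_eq_square)
  then have "cmod a * cmod a = 1" using assms by (metis norm_mult)
  then have "(cmod a)\<^sup>2 = 1" by (simp add: power2_eq_square)
  then have na: "cmod a = 1" by (simp add: abs_square_eq_1)
  then show nz: "csqrt \<alpha> \<noteq> 0" by (auto simp: a_def)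
  have ac: "a * cnj a = 1" using na by (simp flip: complex_norm_square)
  show "z = \<alpha> * cnj z \<longleftrightarrow> (\<exists>s. z = complex_of_real s * csqrt \<alpha>)" for z
  proof
    assume z: "z = \<alpha> * cnj z"
    have "z * cnj a = cnj (z * cnj a)"
    proof -
      have "z * cnj a = (a * cnj a) * (a * cnj z)" using z a2 by (metis mult.assoc mult.commute)
      then show ?thesis by (simp add: ac mult.commute)
    qed
    then have "z * cnj a = complex_of_real (Re (z * cnj a))"
      by (metis Reals_cnj_iff of_real_Re)
    then have "z = complex_of_real (Re (z * cnj a)) * a"
      using ac by (metis mult.assoc mult.commute mult.right_neutral)
    then show "\<exists>s. z = complex_of_real s * csqrt \<alpha>" unfolding a_def by blast
  next
    assume "\<exists>s. z = complex_of_real s * csqrt \<alpha>"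
    then obtain s where z: "z = complex_of_real s * a" unfolding a_def by blast
    have "\<alpha> * cnj z = complex_of_real s * a * (a * cnj a)"
      by (simp add: z flip: a2)
    then show "z = \<alpha> * cnj z" by (metis ac z mult.right_neutral)
  qed
qed

definition mirror_circle :: "complex \<Rightarrow> complex \<Rightarrow> (real^4) set"
  where "mirror_circle \<alpha> \<beta> =
    {x \<in> sphere 0 1. zcoord x = \<alpha> * cnj (zcoord x) \<and> wcoord x = \<beta> * cnj (wcoord x)}"

lemma great_circle_mirror_circle:
  assumes "cmod \<alpha> = 1" "cmod \<beta> = 1"
  shows "great_circle (mirror_circle \<alpha> \<beta>)"
proof -
  obtain a where a: "a \<noteq> 0" "\<And>z. z = \<alpha> * cnj z \<longleftrightarrow> (\<exists>s. z = complex_of_real s * a)"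
    using conjugate_multiple_line[OF assms(1)] by metis
  obtain b where b: "b \<noteq> 0" "\<And>z. z = \<beta> * cnj z \<longleftrightarrow> (\<exists>s. z = complex_of_real s * b)"
    using conjugate_multiple_line[OF assms(2)] by metis
  define J where "J = (\<lambda>(s, t). of_coords (complex_of_real s * a) (complex_of_real t * b))"
  have lin: "linear J"
    by (rule linearI) (auto simp: J_def of_coords_def vec_eq_iff forall_4 vector_4_sel algebra_simps)
  have inj: "inj J"
    using a b by (auto intro!: injI simp: J_def eq_of_coords_iff)
  have "dim (range J) = dim (UNIV :: (real \<times> real) set)"
    using inj by (intro dim_image_eq lin) simp
  then have "dim (range J) = 2" by simp
  moreover have "subspace (range J)"
    by (rule linear_subspace_image[OF lin subspace_UNIV])
  moreover have "range J = {x. zcoord x = \<alpha> * cnj (zcoord x) \<and> wcoord x = \<beta> * cnj (wcoord x)}"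
    unfolding a(2) b(2) by (auto simp: J_def image_iff eq_of_coords_iff)
  then have "mirror_circle \<alpha> \<beta> = range J \<inter> sphere 0 1"
    by (auto simp: mirror_circle_def)
  ultimately show ?thesis unfolding great_circle_def by blast
qed

definition mirror_link :: "int \<Rightarrow> int \<Rightarrow> (real^4) set"
  where "mirror_link m n = (\<Union>(\<alpha>, \<beta>)\<in>lens_group m n. mirror_circle \<alpha> \<beta>)"

lemma mirror_link_iff: "x \<in> mirror_link m n \<longleftrightarrow> x \<in> sphere 0 1 \<and>
    (\<exists>(\<alpha>, \<beta>)\<in>lens_group m n. zcoord x = \<alpha> * cnj (zcoord x) \<and> wcoord x = \<beta> * cnj (wcoord x))"
  by (auto simp: mirror_link_def mirror_circle_def)

text \<open>
  The circles are disjoint because a point on two of them has a non-zero coordinate, which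
  determines \<open>\<alpha>\<close> or \<open>\<beta>\<close> and thus the whole group element.
\<close>

lemma great_circle_link_mirror_link:
  assumes "m \<noteq> 0" and swap: "\<bar>q\<bar> = \<bar>m\<bar>" "m dvd p * n - 1"
  shows "great_circle_link (mirror_link m n)"
proof -
  define \<C> where "\<C> = (\<lambda>(\<alpha>, \<beta>). mirror_circle \<alpha> \<beta>) ` lens_group m n"
  have "finite \<C>" using finite_lens_group[OF assms(1)] by (simp add: \<C>_def)
  moreover have "(1, 1) \<in> lens_group m n" by (auto simp: lens_group_def)
  then have "\<C> \<noteq> {}" by (auto simp: \<C>_def)
  moreover have "\<forall>C\<in>\<C>. great_circle C"
    using lens_group_norm by (auto simp: \<C>_def intro!: great_circle_mirror_circle)
  moreover have "pairwise disjnt \<C>"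
  proof -
    have "(\<alpha>, \<beta>) = (\<alpha>', \<beta>')"
      if g: "(\<alpha>, \<beta>) \<in> lens_group m n" "(\<alpha>', \<beta>') \<in> lens_group m n"
        and x: "x \<in> mirror_circle \<alpha> \<beta>" "x \<in> mirror_circle \<alpha>' \<beta>'" for \<alpha> \<beta> \<alpha>' \<beta>' x
    proof -
      have eqs: "zcoord x = \<alpha> * cnj (zcoord x)" "zcoord x = \<alpha>' * cnj (zcoord x)"
        "wcoord x = \<beta> * cnj (wcoord x)" "wcoord x = \<beta>' * cnj (wcoord x)"
        and "x \<in> sphere 0 1"
        using x unfolding mirror_circle_def by blast+
      then have "zcoord x \<noteq> 0 \<or> wcoord x \<noteq> 0"
        using sphere_coords_nonzero by blast
      then have "\<alpha> = \<alpha>' \<or> \<beta> = \<beta>'"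
        using eqs by (metis complex_cnj_zero_iff mult_cancel_right)
      then show ?thesis using lens_group_eq_iff[OF swap g] by blast
    qed
    then show ?thesis by (fastforce simp: \<C>_def pairwise_def disjnt_iff)
  qed
  moreover have "mirror_link m n = \<Union>\<C>" by (auto simp: mirror_link_def \<C>_def)
  ultimately show ?thesis unfolding great_circle_link_def by blast
qed

text \<open>
  Complex conjugation inverts every rotation in the lens group when it conjugates it, so together they
  generate a dihedral group, whose elements are the rotations and their compositions with conjugation.
\<close>

definition dihedral_act :: "(complex \<times> complex) \<times> bool \<Rightarrow> real^4 \<Rightarrow> real^4"
  where "dihedral_act = (\<lambda>((\<alpha>, \<beta>), flip) x.
    if flip then of_coords (\<alpha> * cnj (zcoord x)) (\<beta> * cnj (wcoord x))
    else of_coords (\<alpha> * zcoord x) (\<beta> * wcoord x))"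

lemma dihedral_act_eq_iff:
  "y = dihedral_act ((\<alpha>, \<beta>), flip) x \<longleftrightarrow>
    (if flip then zcoord y = \<alpha> * cnj (zcoord x) \<and> wcoord y = \<beta> * cnj (wcoord x)
     else zcoord y = \<alpha> * zcoord x \<and> wcoord y = \<beta> * wcoord x)"
  by (simp add: dihedral_act_def eq_of_coords_iff)

lemma ex_dihedral_act_iff:
  "(\<exists>g\<in>G \<times> UNIV. y = dihedral_act g x) \<longleftrightarrow>
    (\<exists>(\<alpha>, \<beta>)\<in>G. zcoord y = \<alpha> * zcoord x \<and> wcoord y = \<beta> * wcoord x \<or>
      zcoord y = \<alpha> * cnj (zcoord x) \<and> wcoord y = \<beta> * cnj (wcoord x))"
proof -
  have "(\<exists>g\<in>G \<times> UNIV. y = dihedral_act g x) \<longleftrightarrow> (\<exists>(\<alpha>, \<beta>)\<in>G. \<exists>flip. y = dihedral_act ((\<alpha>, \<beta>), flip) x)"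
    by auto
  then show ?thesis by (simp add: dihedral_act_eq_iff ex_bool_eq case_prod_unfold disj_commute)
qed

lemma continuous_on_dihedral_act: "continuous_on S (dihedral_act g)"
proof -
  obtain \<alpha> \<beta> flip where g: "g = ((\<alpha>, \<beta>), flip)" by (metis prod.exhaust)
  show ?thesis
    by (cases flip) (simp_all add: g dihedral_act_def, (intro continuous_intros)+)
qed

lemma dihedral_act_norms:
  assumes "g \<in> lens_group m n \<times> UNIV"
  shows "cmod (zcoord (dihedral_act g x)) = cmod (zcoord x)"
    "cmod (wcoord (dihedral_act g x)) = cmod (wcoord x)"
proof -
  obtain \<alpha> \<beta> flip where g: "g = ((\<alpha>, \<beta>), flip)" by (metis prod.exhaust)
  then have "cmod \<alpha> = 1" "cmod \<beta> = 1" using assms lens_group_norm by auto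
  then show "cmod (zcoord (dihedral_act g x)) = cmod (zcoord x)"
    "cmod (wcoord (dihedral_act g x)) = cmod (wcoord x)"
    by (simp_all add: g dihedral_act_def norm_mult)
qed

lemma dihedral_act_fixed_imp_mirror_link:
  assumes g: "(\<alpha>, \<beta>) \<in> lens_group m n" "(\<alpha>', \<beta>') \<in> lens_group m n" and x: "x \<in> sphere 0 1"
    and eq: "dihedral_act ((\<alpha>, \<beta>), False) x = dihedral_act ((\<alpha>', \<beta>'), True) x"
  shows "x \<in> mirror_link m n"
proof -
  have nz: "\<alpha> \<noteq> 0" "\<beta> \<noteq> 0" using lens_group_norm[OF g(1)] by auto
  have "\<alpha> * zcoord x = \<alpha>' * cnj (zcoord x)" "\<beta> * wcoord x = \<beta>' * cnj (wcoord x)"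
    using eq by (simp_all add: dihedral_act_def eq_of_coords_iff)
  then have "zcoord x = \<alpha>' / \<alpha> * cnj (zcoord x)" "wcoord x = \<beta>' / \<beta> * cnj (wcoord x)"
    using nz by (simp_all add: nonzero_eq_divide_eq mult.commute)
  then show ?thesis
    using lens_group_divide[OF g(2,1)] x unfolding mirror_link_iff by blast
qed

text \<open>
  If a rotation and a conjugate-linear map agree at a point, then so does their quotient, a
  conjugate-linear element of the group, with the identity; so the point lies on a mirror circle.
  Two maps of the same kind that agree at a point are equal, because some coordinate of the point is
  non-zero and either component determines a group element.
\<close>

lemma dihedral_act_free:
  assumes swap: "\<bar>q\<bar> = \<bar>m\<bar>" "m dvd p * n - 1"
    and g: "g \<in> lens_group m n \<times> UNIV" "g' \<in> lens_group m n \<times> UNIV"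
    and x: "x \<in> sphere 0 1 - mirror_link m n" and eq: "dihedral_act g x = dihedral_act g' x"
  shows "g = g'"
proof -
  obtain \<alpha> \<beta> flip where gd: "g = ((\<alpha>, \<beta>), flip)" by (metis prod.exhaust)
  obtain \<alpha>' \<beta>' flip' where gd': "g' = ((\<alpha>', \<beta>'), flip')" by (metis prod.exhaust)
  have mem: "(\<alpha>, \<beta>) \<in> lens_group m n" "(\<alpha>', \<beta>') \<in> lens_group m n"
    using g by (auto simp: gd gd')
  have nz: "zcoord x \<noteq> 0 \<or> wcoord x \<noteq> 0"
    using x sphere_coords_nonzero by blast
  have same: "flip = flip'"
    using dihedral_act_fixed_imp_mirror_link[OF mem] dihedral_act_fixed_imp_mirror_link[OF mem(2,1)]
      x eq unfolding gd gd' by (cases flip; cases flip') auto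
  have "\<alpha> = \<alpha>' \<or> \<beta> = \<beta>'"
    using eq nz unfolding gd gd' same
    by (cases flip') (auto simp: dihedral_act_def eq_of_coords_iff)
  then have "\<alpha> = \<alpha>' \<and> \<beta> = \<beta>'" using lens_group_eq_iff[OF swap mem] by blast
  then show ?thesis by (simp add: gd gd' same)
qed

section \<open>The quotient of the three-sphere by the dihedral group\<close>

text \<open>
  The two-bridge link as the union of the arcs in two balls, with the gluing map described in the
  angular coordinates of the Clifford torus.
\<close>

locale glued_balls =
  fixes m n p q :: int and h :: "real \<times> real \<times> real \<Rightarrow> real \<times> real \<times> real"
    and f f' :: "real \<times> real \<times> real \<Rightarrow> real^4" and K :: "(real^4) set"
  assumes q_nonzero: "q \<noteq> 0"
    and order: "\<bar>q\<bar> = \<bar>m\<bar>" "m dvd p * n - 1"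
    and gluing: "\<And>\<theta> \<phi>. h (pillow (of_int m * \<theta>, of_int n * \<theta> + \<phi>)) = pillow (of_int q * \<phi>, of_int p * \<phi> + \<theta>)"
    and f: "continuous_on pillow_ball f" "inj_on f pillow_ball"
    and f': "continuous_on pillow_ball f'" "inj_on f' pillow_ball"
    and cover: "f ` pillow_ball \<union> f' ` pillow_ball = sphere 0 1"
    and overlap: "f ` pillow_ball \<inter> f' ` pillow_ball = f ` pillowcase"
    and glue: "\<And>x. x \<in> pillowcase \<Longrightarrow> f x = f' (h x)"
    and h_pillowcase: "h ` pillowcase = pillowcase"
    and K_def: "K = f ` vertical_arcs \<union> f' ` vertical_arcs"
begin

definition proj :: "real^4 \<Rightarrow> real^4"
  where "proj x = (if cmod (wcoord x) \<le> cmod (zcoord x)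
    then f (lens_fold m n (zcoord x) (wcoord x))
    else f' (lens_fold q p (wcoord x) (zcoord x)))"

definition zside :: "(real^4) set"
  where "zside = {x \<in> sphere 0 1. cmod (wcoord x) \<le> cmod (zcoord x)}"

definition wside :: "(real^4) set"
  where "wside = {x \<in> sphere 0 1. cmod (zcoord x) \<le> cmod (wcoord x)}"

lemma m_nonzero: "m \<noteq> 0"
  using q_nonzero order by auto

lemma sides: "zside \<union> wside = sphere 0 1"
  by (auto simp: zside_def wside_def)

lemma zside_nonzero: "x \<in> zside \<Longrightarrow> zcoord x \<noteq> 0"
  using sphere_coords_nonzero[of x] by (auto simp: zside_def)

lemma wside_nonzero: "x \<in> wside \<Longrightarrow> wcoord x \<noteq> 0"
  using sphere_coords_nonzero[of x] by (auto simp: wside_def)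

lemma proj_zside: "x \<in> zside \<Longrightarrow> proj x = f (lens_fold m n (zcoord x) (wcoord x))"
  by (simp add: proj_def zside_def)

text \<open>
  The two formulas for the projection agree on the Clifford torus. This is the property for which
  \<open>m\<close> and \<open>n\<close> were chosen.
\<close>

lemma lens_fold_gluing:
  assumes "z \<noteq> 0" "cmod w = cmod z"
  shows "f (lens_fold m n z w) = f' (lens_fold q p w z)"
proof -
  have nz: "w \<noteq> 0" using assms by auto
  have polar: "sgn z = cis (pi * (Arg z / pi))" "sgn w = cis (pi * (Arg w / pi))"
    using assms(1) nz by (simp_all add: cis_Arg)
  have "lens_fold m n z w \<in> pillowcase"
    using lens_fold_in_pillowcase_iff[of z w] assms by simp
  then show ?thesis
    using lens_fold_torus[OF assms polar, of m n] lens_fold_torus[OF nz assms(2)[symmetric] polar(2,1), of q p]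
    by (simp only: glue gluing)
qed

lemma proj_wside: "x \<in> wside \<Longrightarrow> proj x = f' (lens_fold q p (wcoord x) (zcoord x))"
  using wside_nonzero[of x] lens_fold_gluing[of "zcoord x" "wcoord x"]
  by (cases "zcoord x = 0") (auto simp: proj_def wside_def)

lemma fold_in_ball:
  "x \<in> zside \<Longrightarrow> lens_fold m n (zcoord x) (wcoord x) \<in> pillow_ball"
  "x \<in> wside \<Longrightarrow> lens_fold q p (wcoord x) (zcoord x) \<in> pillow_ball"
  using lens_fold_in_ball zside_nonzero wside_nonzero by (auto simp: zside_def wside_def)

text \<open>
  Points that land in both balls come from the Clifford torus. Thus questions about two points, or
  about the arcs of the other ball, reduce to a single solid torus.
\<close>

lemma proj_in_overlap:
  assumes x: "x \<in> sphere 0 1" and "proj x \<in> f ` pillow_ball" "proj x \<in> f' ` pillow_ball"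
  shows "x \<in> zside \<inter> wside"
proof -
  have c: "proj x \<in> f ` pillowcase" using assms overlap by blast
  have sub: "pillowcase \<subseteq> pillow_ball"
    using frontier_subset_closed[OF pillow_ball_closed] by (simp add: frontier_pillow_ball)
  consider "x \<in> zside" | "x \<in> wside" using x sides by blast
  then have "cmod (wcoord x) = cmod (zcoord x)"
  proof cases
    case 1
    then have "lens_fold m n (zcoord x) (wcoord x) \<in> pillowcase"
      using c inj_on_image_mem_iff[OF f(2) fold_in_ball(1)[OF 1] sub] by (simp add: proj_zside 1)
    then show ?thesis
      using lens_fold_in_pillowcase_iff zside_nonzero[OF 1] 1 by (auto simp: zside_def)
  next
    case 2
    have "f ` pillowcase = f' ` pillowcase"
      using glue h_pillowcase by (metis image_image image_cong)
    then have "lens_fold q p (wcoord x) (zcoord x) \<in> pillowcase"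
      using c inj_on_image_mem_iff[OF f'(2) fold_in_ball(2)[OF 2] sub] by (simp add: proj_wside 2)
    then show ?thesis
      using lens_fold_in_pillowcase_iff wside_nonzero[OF 2] 2 by (auto simp: wside_def)
  qed
  then show ?thesis using x by (auto simp: zside_def wside_def)
qed

lemma continuous_on_proj: "continuous_on (sphere 0 1) proj"
proof -
  let ?d = "\<lambda>x. cmod (wcoord x) - cmod (zcoord x)"
  have "continuous_on {x \<in> sphere 0 1. ?d x \<le> 0} (\<lambda>x. f (lens_fold m n (zcoord x) (wcoord x)))"
    using zside_nonzero fold_in_ball(1)
    by (intro continuous_on_compose2[OF f(1)] continuous_intros) (auto simp: zside_def)
  moreover have "continuous_on {x \<in> sphere 0 1. 0 \<le> ?d x} (\<lambda>x. f' (lens_fold q p (wcoord x) (zcoord x)))"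
    using wside_nonzero fold_in_ball(2)
    by (intro continuous_on_compose2[OF f'(1)] continuous_intros) (auto simp: wside_def)
  moreover have "continuous_on (sphere 0 1) ?d" by (intro continuous_intros)
  ultimately have "continuous_on (sphere 0 1) (\<lambda>x. if ?d x \<le> 0
      then f (lens_fold m n (zcoord x) (wcoord x)) else f' (lens_fold q p (wcoord x) (zcoord x)))"
  proof (rule continuous_on_cases_le)
    fix x :: "real^4" assume "x \<in> sphere 0 1" "?d x = 0"
    then show "f (lens_fold m n (zcoord x) (wcoord x)) = f' (lens_fold q p (wcoord x) (zcoord x))"
      using sphere_coords_nonzero[of x] by (intro lens_fold_gluing) auto
  qed
  then show ?thesis by (simp add: proj_def[abs_def])
qed

lemma proj_image: "proj ` sphere 0 1 = sphere 0 1"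
proof
  show "proj ` sphere 0 1 \<subseteq> sphere 0 1"
  proof (rule image_subsetI)
    fix x :: "real^4" assume "x \<in> sphere 0 1"
    then consider "x \<in> zside" | "x \<in> wside" using sides by blast
    then show "proj x \<in> sphere 0 1"
      unfolding cover[symmetric]
      by cases (simp_all add: proj_zside proj_wside fold_in_ball)
  qed
  have "f b \<in> proj ` sphere 0 1" if b: "b \<in> pillow_ball" for b
  proof -
    obtain z w where zw: "z \<noteq> 0" "cmod w \<le> cmod z" "(cmod z)\<^sup>2 + (cmod w)\<^sup>2 = 1" "lens_fold m n z w = b"
      using lens_fold_surj[OF m_nonzero b] by blast
    then have "of_coords z w \<in> zside" by (simp add: zside_def sphere_coords del: mem_sphere mem_sphere_0)
    then show ?thesis using zw sides by (intro image_eqI[of _ _ "of_coords z w"]) (auto simp: proj_zside)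
  qed
  moreover have "f' b \<in> proj ` sphere 0 1" if b: "b \<in> pillow_ball" for b
  proof -
    obtain z w where zw: "z \<noteq> 0" "cmod w \<le> cmod z" "(cmod z)\<^sup>2 + (cmod w)\<^sup>2 = 1" "lens_fold q p z w = b"
      using lens_fold_surj[OF q_nonzero b] by blast
    then have "of_coords w z \<in> wside" by (simp add: wside_def sphere_coords add.commute del: mem_sphere mem_sphere_0)
    then show ?thesis using zw sides by (intro image_eqI[of _ _ "of_coords w z"]) (auto simp: proj_wside)
  qed
  ultimately have "f ` pillow_ball \<union> f' ` pillow_ball \<subseteq> proj ` sphere 0 1" by blast
  then show "sphere 0 1 \<subseteq> proj ` sphere 0 1" unfolding cover .
qed

text \<open>
  Within one solid torus this is \<open>lens_fold_eq_iff\<close>, on the second side after swapping the roles of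
  the components. If two points on different sides have equal images, then they lie on the Clifford
  torus by \<open>proj_in_overlap\<close>; if they are in a common orbit, then too, because the group preserves
  \<open>|z|\<close> and \<open>|w|\<close>.
\<close>

lemma proj_eq_iff:
  assumes x: "x \<in> sphere 0 1" and y: "y \<in> sphere 0 1"
  shows "proj x = proj y \<longleftrightarrow> (\<exists>g\<in>lens_group m n \<times> UNIV. y = dihedral_act g x)"
proof -
  have zz: ?thesis if "x \<in> zside" "y \<in> zside"
  proof -
    have "proj x = proj y \<longleftrightarrow> lens_fold m n (zcoord x) (wcoord x) = lens_fold m n (zcoord y) (wcoord y)"
      using that f(2) fold_in_ball(1) by (auto simp: proj_zside dest: inj_onD)
    then show ?thesis
      unfolding ex_dihedral_act_iff
      using lens_fold_eq_iff[of "zcoord x" "zcoord y" "wcoord x" "wcoord y" m n] x y that[THEN zside_nonzero]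
      by (simp add: sphere_coords del: mem_sphere mem_sphere_0)
  qed
  have ww: ?thesis if "x \<in> wside" "y \<in> wside"
  proof -
    have "proj x = proj y \<longleftrightarrow> lens_fold q p (wcoord x) (zcoord x) = lens_fold q p (wcoord y) (zcoord y)"
      using that f'(2) fold_in_ball(2) by (auto simp: proj_wside dest: inj_onD)
    also have "\<dots> \<longleftrightarrow> (\<exists>(\<beta>, \<alpha>)\<in>lens_group q p. wcoord y = \<beta> * wcoord x \<and> zcoord y = \<alpha> * zcoord x \<or>
        wcoord y = \<beta> * cnj (wcoord x) \<and> zcoord y = \<alpha> * cnj (zcoord x))"
      using x y that[THEN wside_nonzero]
      by (intro lens_fold_eq_iff) (auto simp: sphere_coords add.commute simp del: mem_sphere mem_sphere_0)
    also have "\<dots> \<longleftrightarrow> (\<exists>(\<alpha>, \<beta>)\<in>lens_group m n. zcoord y = \<alpha> * zcoord x \<and> wcoord y = \<beta> * wcoord x \<or>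
        zcoord y = \<alpha> * cnj (zcoord x) \<and> wcoord y = \<beta> * cnj (wcoord x))"
      using lens_group_swap[OF order] by fast
    finally show ?thesis unfolding ex_dihedral_act_iff .
  qed
  have norms: "y \<in> zside \<longleftrightarrow> x \<in> zside" "y \<in> wside \<longleftrightarrow> x \<in> wside"
    if "\<exists>g\<in>lens_group m n \<times> UNIV. y = dihedral_act g x"
    using that x y dihedral_act_norms by (auto simp: zside_def wside_def)
  have mixed: "x \<in> zside \<inter> wside \<or> y \<in> zside \<inter> wside"
    if "proj x = proj y" "x \<in> zside \<and> y \<in> wside \<or> x \<in> wside \<and> y \<in> zside"
  proof -
    have "proj x \<in> f ` pillow_ball" "proj x \<in> f' ` pillow_ball"
      using that fold_in_ball by (metis image_eqI proj_zside proj_wside)+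
    then show ?thesis using proj_in_overlap[OF x] by blast
  qed
  show ?thesis
  proof (cases "(x \<in> zside \<and> y \<in> zside) \<or> (x \<in> wside \<and> y \<in> wside)")
    case True
    then show ?thesis using zz ww by blast
  next
    case False
    then have "x \<in> zside \<and> y \<in> wside \<or> x \<in> wside \<and> y \<in> zside" using x y sides by blast
    then show ?thesis using False mixed norms by blast
  qed
qed

lemma proj_in_K_iff:
  assumes x: "x \<in> sphere 0 1"
  shows "proj x \<in> K \<longleftrightarrow> x \<in> mirror_link m n"
proof -
  have sub: "vertical_arcs \<subseteq> pillow_ball"
  proof
    fix v assume "v \<in> vertical_arcs"
    then obtain a b where v: "v = (a, b, 0)" "\<bar>b\<bar> \<le> 1" "\<bar>a\<bar> = (1 + b\<^sup>2) / 2"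
      by (auto simp: vertical_arcs_def)
    then have "b\<^sup>2 \<le> 1" by (simp add: abs_square_le_1)
    moreover from this have "\<bar>a\<bar> \<le> 1" using v by simp
    ultimately show "v \<in> pillow_ball"
      using v(2) by (simp add: v(1) pillow_ball_def abs_square_le_1)
  qed
  have z: "proj x \<in> f ` vertical_arcs \<longleftrightarrow> x \<in> mirror_link m n" if "x \<in> zside"
  proof -
    have "proj x \<in> f ` vertical_arcs \<longleftrightarrow> lens_fold m n (zcoord x) (wcoord x) \<in> vertical_arcs"
      using inj_on_image_mem_iff[OF f(2) fold_in_ball(1)[OF that] sub] by (simp add: proj_zside that)
    then show ?thesis
      using x that zside_nonzero[OF that] lens_fold_in_vertical_arcs_iff[of "zcoord x" "wcoord x" m n]
      by (simp add: mirror_link_iff zside_def)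
  qed
  have w: "proj x \<in> f' ` vertical_arcs \<longleftrightarrow> x \<in> mirror_link m n" if "x \<in> wside"
  proof -
    have "proj x \<in> f' ` vertical_arcs \<longleftrightarrow> lens_fold q p (wcoord x) (zcoord x) \<in> vertical_arcs"
      using inj_on_image_mem_iff[OF f'(2) fold_in_ball(2)[OF that] sub] by (simp add: proj_wside that)
    also have "\<dots> \<longleftrightarrow> (\<exists>(\<beta>, \<alpha>)\<in>lens_group q p. wcoord x = \<beta> * cnj (wcoord x) \<and> zcoord x = \<alpha> * cnj (zcoord x))"
      using that wside_nonzero[OF that] by (intro lens_fold_in_vertical_arcs_iff) (auto simp: wside_def)
    also have "\<dots> \<longleftrightarrow> (\<exists>(\<alpha>, \<beta>)\<in>lens_group m n. zcoord x = \<alpha> * cnj (zcoord x) \<and> wcoord x = \<beta> * cnj (wcoord x))"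
      using lens_group_swap[OF order] by fast
    finally show ?thesis using x by (simp add: mirror_link_iff)
  qed
  consider "x \<in> zside \<inter> wside" | "x \<in> zside" "x \<notin> wside" | "x \<in> wside" "x \<notin> zside"
    using x sides by blast
  then show ?thesis
  proof cases
    case 1
    then show ?thesis using z w by (auto simp: K_def)
  next
    case 2
    then have "proj x \<notin> f' ` vertical_arcs"
      using proj_in_overlap[OF x] sub fold_in_ball(1) proj_zside by blast
    then show ?thesis using z 2 by (auto simp: K_def)
  next
    case 3
    then have "proj x \<notin> f ` vertical_arcs"
      using proj_in_overlap[OF x] sub fold_in_ball(2) proj_wside by blast
    then show ?thesis using w 3 by (auto simp: K_def)
  qed
qed

lemma finite_sheeted_covering_proj:
  "finite_sheeted_covering (sphere 0 1 - mirror_link m n) proj (sphere 0 1 - K)"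
proof (rule finite_sheeted_covering_free_action[where G = "lens_group m n \<times> UNIV" and act = dihedral_act])
  let ?E = "sphere 0 1 - mirror_link m n" and ?X = "sphere 0 1 - K"
  show "continuous_on ?E proj" by (rule continuous_on_subset[OF continuous_on_proj]) blast
  have image: "proj ` (A - mirror_link m n) = proj ` A - K" if "A \<subseteq> sphere 0 1" for A
    using that proj_in_K_iff by blast
  show "proj ` ?E = ?X"
    unfolding image[OF order_refl] proj_image ..
  fix C assume "closedin (top_of_set ?E) C"
  then obtain D where D: "closed D" "C = ?E \<inter> D" by (auto simp: closedin_closed)
  have "compact (proj ` (sphere 0 1 \<inter> D))"
    using D(1) by (intro compact_continuous_image continuous_on_subset[OF continuous_on_proj] compact_Int_closed) auto
  moreover have "proj ` C = ?X \<inter> proj ` (sphere 0 1 \<inter> D)"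
  proof -
    have "C = sphere 0 1 \<inter> D - mirror_link m n" using D(2) by blast
    then have "proj ` C = proj ` (sphere 0 1 \<inter> D) - K" by (simp add: image)
    then show ?thesis using proj_image by blast
  qed
  ultimately show "closedin (top_of_set ?X) (proj ` C)"
    by (simp add: closedin_closed_Int compact_imp_closed)
next
  show "finite (lens_group m n \<times> (UNIV :: bool set))"
    using finite_lens_group[OF m_nonzero] by simp
next
  fix g :: "(complex \<times> complex) \<times> bool" assume g: "g \<in> lens_group m n \<times> UNIV"
  show "continuous_on (sphere 0 1 - mirror_link m n) (dihedral_act g)"
    by (rule continuous_on_dihedral_act)
  have "dihedral_act g x \<in> sphere 0 1 - mirror_link m n" if x: "x \<in> sphere 0 1 - mirror_link m n" for x
  proof -
    have s: "x \<in> sphere 0 1" "dihedral_act g x \<in> sphere 0 1"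
      using x dihedral_act_norms[OF g] by (auto simp: sphere_coords simp del: mem_sphere mem_sphere_0)
    then have "proj x = proj (dihedral_act g x)" using proj_eq_iff g by blast
    then show ?thesis using x s proj_in_K_iff by (metis Diff_iff)
  qed
  then show "dihedral_act g ` (sphere 0 1 - mirror_link m n) \<subseteq> sphere 0 1 - mirror_link m n" by blast
next
  fix x y assume "x \<in> sphere 0 1 - mirror_link m n" "y \<in> sphere 0 1 - mirror_link m n"
  then show "proj x = proj y \<longleftrightarrow> (\<exists>g\<in>lens_group m n \<times> UNIV. y = dihedral_act g x)"
    by (intro proj_eq_iff) auto
qed (rule dihedral_act_free[OF order])

end

theorem lemma4:
  fixes p q :: int and K :: "(real^4) set"
  assumes "coprime p q" and "q \<noteq> 0" and "two_bridge p q K"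
  shows "\<exists>L. great_circle_link L \<and>
    (\<exists>c. finite_sheeted_covering (sphere 0 1 - L) c (sphere 0 1 - K))"
proof -
  from assms(3) obtain h f f' where glue: "two_bridge_gluing p q h"
    and f: "continuous_on pillow_ball f" "inj_on f pillow_ball"
    and f': "continuous_on pillow_ball f'" "inj_on f' pillow_ball"
    and S: "f ` pillow_ball \<union> f' ` pillow_ball = sphere 0 1"
      "f ` pillow_ball \<inter> f' ` pillow_ball = f ` pillowcase"
    and fh: "\<And>x. x \<in> pillowcase \<Longrightarrow> f x = f' (h x)"
    and K: "K = f ` vertical_arcs \<union> f' ` vertical_arcs"
    unfolding two_bridge_def by blast
  have "h ` pillowcase = pillowcase"
    using glue by (auto simp: two_bridge_gluing_def homeomorphism_def)
  moreover obtain m n where mn: "\<bar>q\<bar> = \<bar>m\<bar>" "m dvd p * n - 1"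
    "\<And>\<theta> \<phi>. h (pillow (of_int m * \<theta>, of_int n * \<theta> + \<phi>)) = pillow (of_int q * \<phi>, of_int p * \<phi> + \<theta>)"
    using two_bridge_gluing_lens[OF glue assms(1,2)] by blast
  ultimately interpret glued_balls m n p q h f f' K
    using assms(2) f f' S fh K by unfold_locales
  show ?thesis
    using great_circle_link_mirror_link[OF m_nonzero order] finite_sheeted_covering_proj by blast
qed

end
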